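(* Let $P=(P(i,j))_{(i,j)\in\mathbb{N}^2}$ be an irreducible and aperiodic Markov kernel on $\mathbb{N}$ with a unique invariant probability measure $\pi$. Let $V=(V(n))_{n\in\mathbb{N}}$ be an unbounded increasing sequence of positive real numbers such that $$\exists\,\delta\in[0,1),\ \exists\,L>0,\qquad PV\le\delta V+L\,1_{\mathbb{N}} .$$ Then, for this $\delta$, either $$\varrho_V\le\delta\quad\text{and}\quad\limsup_{k}\rho_k\le\delta,$$ or $$\varrho_V>\delta\quad\text{and}\quad\varrho_V=\lim_k\rho_k .$$
   Context: $\mathbb{N}=\{0,1,2,\ldots\}$; $(Pf)(i)=\sum_jP(i,j)f(j)$; $1_{\mathbb{N}}$ is the constant sequence $1$; inequalities between sequences are pointwise. No band condition on $P$ is assumed. $\mathcal{B}_V$ is the Banach space of complex sequences $g=(g(n))_{n\in\mathbb{N}}$ with $\|g\|_V:=\sup_nV(n)^{-1}|g(n)|<\infty$. $\Pi f:=\pi(f)1_{\mathbb{N}}$ with $\pi(f):=\sum_{i\ge0}f(i)\pi(i)$. $\varrho_V$ is the infimum of the $\rho\in(0,1)$ for which there exists $C\in(0,+\infty)$ such that $\|P^nf-\Pi f\|_V\le C\rho^n\|f\|_V$ for all $n\ge1$ and $f\in\mathcal{B}_V$. For $k\ge1$, $P_k$ is the $k$-th truncated matrix of $P$ augmented on the last column, i.e. the stochastic matrix on $\{0,\ldots,k\}$ given, for $0\le i\le k$, by $P_k(i,j)=P(i,j)$ if $0\le j\le k-1$ and $P_k(i,k)=\sum_{j\ge k}P(i,j)$.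 With $\sigma(P_k)$ the set of (complex) eigenvalues of $P_k$, $\rho_k:=\max\{|\lambda| : \lambda\in\sigma(P_k),\ |\lambda|<1\}$ (with value $0$ if this set is empty). *)

theory Defs
  imports "HOL-Analysis.Analysis" "Jordan_Normal_Form.Spectral_Radius"
begin

definition markov_kernel :: "(nat \<Rightarrow> nat \<Rightarrow> real) \<Rightarrow> bool" where
  "markov_kernel P \<longleftrightarrow> (\<forall>i j. 0 \<le> P i j) \<and> (\<forall>i. (\<lambda>j. P i j) sums 1)"

fun kernel_pow :: "(nat \<Rightarrow> nat \<Rightarrow> real) \<Rightarrow> nat \<Rightarrow> nat \<Rightarrow> nat \<Rightarrow> real" where
  "kernel_pow P 0 i j = (if i = j then 1 else 0)"
| "kernel_pow P (Suc n) i j = (\<Sum>l. P i l * kernel_pow P n l j)"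

definition irreducible_kernel :: "(nat \<Rightarrow> nat \<Rightarrow> real) \<Rightarrow> bool" where
  "irreducible_kernel P \<longleftrightarrow> (\<forall>i j. \<exists>n. 0 < kernel_pow P n i j)"

definition aperiodic_kernel :: "(nat \<Rightarrow> nat \<Rightarrow> real) \<Rightarrow> bool" where
  "aperiodic_kernel P \<longleftrightarrow> (\<forall>i. Gcd {n. 1 \<le> n \<and> 0 < kernel_pow P n i i} = 1)"

definition invariant_prob :: "(nat \<Rightarrow> nat \<Rightarrow> real) \<Rightarrow> (nat \<Rightarrow> real) \<Rightarrow> bool" where
  "invariant_prob P p \<longleftrightarrow>
     (\<forall>i. 0 \<le> p i) \<and> p sums 1 \<and> (\<forall>j. (\<lambda>i. p i * P i j) sums p j)"

text \<open>Polymorphic, so that it acts on real as well as on complex sequences. The value is only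
  meaningful where the series converges.\<close>

definition kernel_op :: "(nat \<Rightarrow> nat \<Rightarrow> real) \<Rightarrow> (nat \<Rightarrow> 'a::real_normed_vector) \<Rightarrow> nat \<Rightarrow> 'a" where
  "kernel_op P f i = (\<Sum>j. P i j *\<^sub>R f j)"

definition mean_proj :: "(nat \<Rightarrow> real) \<Rightarrow> (nat \<Rightarrow> complex) \<Rightarrow> nat \<Rightarrow> complex" where
  "mean_proj p f = (\<lambda>_. \<Sum>i. f i * complex_of_real (p i))"

definition weighted_space :: "(nat \<Rightarrow> real) \<Rightarrow> (nat \<Rightarrow> complex) set" where
  "weighted_space V = {g. bdd_above (range (\<lambda>n. inverse (V n) * cmod (g n)))}"

definition weighted_norm :: "(nat \<Rightarrow> real) \<Rightarrow> (nat \<Rightarrow> complex) \<Rightarrow> real" where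
  "weighted_norm V g = (SUP n. inverse (V n) * cmod (g n))"

text \<open>The membership clause says that the norm on the left of the inequality is finite; a real
  supremum over an unbounded set would be an unspecified number.\<close>

definition geometric_rate ::
    "(nat \<Rightarrow> nat \<Rightarrow> real) \<Rightarrow> (nat \<Rightarrow> real) \<Rightarrow> (nat \<Rightarrow> real) \<Rightarrow> real \<Rightarrow> bool" where
  "geometric_rate P p V r \<longleftrightarrow>
     (\<exists>C>0. \<forall>n\<ge>1. \<forall>f\<in>weighted_space V.
        (\<lambda>i. (kernel_op P ^^ n) f i - mean_proj p f i) \<in> weighted_space V \<and>
        weighted_norm V (\<lambda>i. (kernel_op P ^^ n) f i - mean_proj p f i)
          \<le> C * r ^ n * weighted_norm V f)"

text \<open>Extended real, so that the infimum of the empty set is \<open>\<infinity>\<close>.\<close>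

definition conv_rate :: "(nat \<Rightarrow> nat \<Rightarrow> real) \<Rightarrow> (nat \<Rightarrow> real) \<Rightarrow> (nat \<Rightarrow> real) \<Rightarrow> ereal" where
  "conv_rate P p V = Inf (ereal ` {r. 0 < r \<and> r < 1 \<and> geometric_rate P p V r})"

definition trunc_mat :: "(nat \<Rightarrow> nat \<Rightarrow> real) \<Rightarrow> nat \<Rightarrow> complex mat" where
  "trunc_mat P k = mat (Suc k) (Suc k)
     (\<lambda>(i, j). complex_of_real (if j < k then P i j else (\<Sum>l. P i (k + l))))"

definition trunc_rate :: "(nat \<Rightarrow> nat \<Rightarrow> real) \<Rightarrow> nat \<Rightarrow> real" where
  "trunc_rate P k =
     (let S = {z \<in> spectrum (trunc_mat P k). cmod z < 1}
      in if S = {} then 0 else Max (cmod ` S))"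

end

theory Submission
  imports Defs "HOL-Complex_Analysis.Complex_Analysis"
begin

text \<open>The eigenvalues of modulus above \<open>\<delta>\<close> of \<open>P\<close> and of its truncations are the reciprocals of the
zeros of holomorphic functions, and these functions converge.

Fix \<open>r > \<delta>\<close>. As \<open>V\<close> is unbounded, the drift condition gives \<open>P V \<le> r V\<close> on all rows with
index at least some \<open>N\<close>. So \<open>P\<close> is the sum of an operator \<open>T\<close> of norm at most \<open>r\<close> on the weighted
space and of an operator of rank at most \<open>N\<close>, namely the first \<open>N\<close> rows. For \<open>\<bar>w\<bar> r < 1\<close> the resolvent
equation \<open>g = f + w P g\<close> reduces, through the Neumann series of \<open>T\<close>, to \<open>N\<close> linear equations,
and the determinant of that system is holomorphic in \<open>\<bar>w\<bar> < 1 / r\<close>. Its zeros are the reciprocals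
of the eigenvalues of modulus above \<open>r\<close> (\<open>split_det_zero_iff\<close>, for the centred operator below). The truncated matrix \<open>P\<^sub>k\<close>, extended to
\<open>\<nat>\<close> by clipping indices at \<open>k\<close>, satisfies the same drift condition because \<open>V\<close> increases, so the same
\<open>r\<close> and \<open>N\<close> serve for all truncations at once.

The trivial eigenvalue 1 is removed in advance: \<open>P\<close> is replaced by the centred operator
\<open>f \<mapsto> P f - (P f)(0)\<close>. Let \<open>E\<close> be the set of its eigenvalues of modulus above \<open>\<delta>\<close>.

\<^item> By Tannery's theorem the determinants of the truncations converge uniformly on compact discs
  (\<open>reduced_det_uniform_limit\<close>). Discs without zeros therefore remain without zeros
  (\<open>no_centred_eigenvalue_limit\<close>), and by Hurwitz's theorem every zero is approximated
  (\<open>centred_eigenvalue_limit\<close>). So the truncated rates tend to the supremum of the moduli in \<open>E\<close>, or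
  have upper limit at most \<open>\<delta>\<close> if \<open>E\<close> is empty.

\<^item> If no element of \<open>E\<close> has modulus at least \<open>\<rho>\<close>, the resolvent is holomorphic and bounded up to
  radius \<open>1 / \<rho>\<close>, and Cauchy's inequality yields the geometric rate \<open>\<rho>\<close> (\<open>perturbed_power_bound\<close>,
  \<open>geometric_rateI\<close>); conversely, an eigenfunction rules out smaller rates (\<open>geometric_rate_ge\<close>).
  So the convergence rate is the same supremum.

\<^item> All elements of \<open>E\<close> lie in the open unit disc (\<open>centred_eigenvalue_kernel_less_1\<close>). This is where
  irreducibility and aperiodicity are used: an eigenfunction for \<open>\<bar>z\<bar> \<ge> 1\<close> is bounded by the drift
  condition, and then constant.\<close>

section \<open>Determinants of matrices with variable entries\<close>

text \<open>Matrices enter with their entries given by a function of two indices, since below both the entries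
and the size are produced by an analytic construction; the determinant is then a finite sum of
products of entries, and limits and holomorphy pass through it.\<close>

definition fun_det :: "nat \<Rightarrow> (nat \<Rightarrow> nat \<Rightarrow> complex) \<Rightarrow> complex" where
  "fun_det N m = det (mat N N (\<lambda>(a, b). m a b))"

lemma fun_det_expand:
  "fun_det N m = (\<Sum>p | p permutes {0..<N}. signof p * (\<Prod>i = 0..<N. m i (p i)))"
proof -
  have "fun_det N m = (\<Sum>p | p permutes {0..<N}.
      signof p * (\<Prod>i = 0..<N. mat N N (\<lambda>(a, b). m a b) $$ (i, p i)))"
    unfolding fun_det_def by (rule det_def') simp
  also have "\<dots> = (\<Sum>p | p permutes {0..<N}. signof p * (\<Prod>i = 0..<N. m i (p i)))"
    by (intro sum.cong refl arg_cong2[of _ _ _ _ "(*)"] prod.cong)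
       (auto dest: permutes_in_image)
  finally show ?thesis .
qed

lemma fun_det_eq_0_iff:
  "fun_det N m = 0 \<longleftrightarrow> (\<exists>u. (\<exists>a<N. u a \<noteq> 0) \<and> (\<forall>a<N. (\<Sum>b<N. m a b * u b) = 0))"
proof -
  let ?A = "mat N N (\<lambda>(a, b). m a b)"
  have A: "?A \<in> carrier_mat N N" by simp
  have row_sum: "vec_index (?A *\<^sub>v v) a = (\<Sum>b<N. m a b * vec_index v b)"
    if "a < N" "v \<in> carrier_vec N" for v a
    using that by (auto simp: scalar_prod_def atLeast0LessThan intro!: sum.cong)
  show ?thesis
    unfolding fun_det_def det_0_iff_vec_prod_zero[OF A]
  proof safe
    fix v assume v: "v \<in> carrier_vec N" "v \<noteq> 0\<^sub>v N" "?A *\<^sub>v v = 0\<^sub>v N"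
    show "\<exists>u. (\<exists>a<N. u a \<noteq> 0) \<and> (\<forall>a<N. (\<Sum>b<N. m a b * u b) = 0)"
    proof (intro exI[of _ "vec_index v"] conjI allI impI)
      show "\<exists>a<N. vec_index v a \<noteq> 0"
        using v(1,2) by (metis carrier_vecD eq_vecI index_zero_vec(1,2))
      show "(\<Sum>b<N. m a b * vec_index v b) = 0" if "a < N" for a
        using row_sum[OF that v(1)] v(3) that by simp
    qed
  next
    fix u a assume u: "\<forall>a<N. (\<Sum>b<N. m a b * u b) = 0" "a < N" "u a \<noteq> 0"
    show "\<exists>v. v \<in> carrier_vec N \<and> v \<noteq> 0\<^sub>v N \<and> ?A *\<^sub>v v = 0\<^sub>v N"
    proof (intro exI[of _ "vec N u"] conjI)
      show "vec N u \<noteq> 0\<^sub>v N" using u(2,3) by (metis index_vec index_zero_vec(1))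
      show "?A *\<^sub>v vec N u = 0\<^sub>v N"
      proof (rule eq_vecI)
        fix a assume "a < dim_vec (0\<^sub>v N :: complex vec)"
        then have a: "a < N" by simp
        have "vec_index (?A *\<^sub>v vec N u) a = (\<Sum>b<N. m a b * vec_index (vec N u) b)"
          by (rule row_sum) (use a in auto)
        also have "\<dots> = (\<Sum>b<N. m a b * u b)" by simp
        finally show "vec_index (?A *\<^sub>v vec N u) a = vec_index (0\<^sub>v N) a" using u(1) a by simp
      qed simp
    qed simp
  qed
qed

text \<open>The sign and the minor obtained by deleting row \<open>i\<close> and column \<open>j\<close>; for indices in
range this is the usual cofactor.\<close>

definition fun_cofactor :: "nat \<Rightarrow> (nat \<Rightarrow> nat \<Rightarrow> complex) \<Rightarrow> nat \<Rightarrow> nat \<Rightarrow> complex" where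
  "fun_cofactor N m i j = (-1) ^ (i + j) * fun_det (N - 1)
     (\<lambda>a b. m (if a < i then a else Suc a) (if b < j then b else Suc b))"

text \<open>Cramer's rule without a division: it holds for singular matrices as well, so both sides can be
compared as holomorphic functions of a parameter before the zeros of the determinant are known.\<close>

lemma fun_det_cramer:
  assumes "\<And>a. a < N \<Longrightarrow> (\<Sum>b<N. m a b * u b) = v a" and "c < N"
  shows "fun_det N m * u c = (\<Sum>a<N. fun_cofactor N m a c * v a)"
proof -
  let ?A = "mat N N (\<lambda>(a, b). m a b)"
  have A: "?A \<in> carrier_mat N N" by simp
  have cof: "cofactor ?A a b = fun_cofactor N m a b" if "a < N" "b < N" for a b
  proof -
    have "mat_delete ?A a b = mat (N - 1) (N - 1)
        (\<lambda>(i, j). m (if i < a then i else Suc i) (if j < b then j else Suc j))"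
      unfolding mat_delete_def using that by (intro eq_matI) auto
    then show ?thesis unfolding cofactor_def fun_cofactor_def fun_det_def by simp
  qed
  have inv: "(\<Sum>a<N. fun_cofactor N m a c * m a b) = (if c = b then fun_det N m else 0)"
    if b: "b < N" for b
  proof -
    have "(adj_mat ?A * ?A) $$ (c, b) = (\<Sum>a<N. cofactor ?A a c * m a b)"
      using b assms(2) by (auto simp: adj_mat_def scalar_prod_def atLeast0LessThan intro!: sum.cong)
    then have "(\<Sum>a<N. cofactor ?A a c * m a b) = (if c = b then fun_det N m else 0)"
      using adj_mat(3)[OF A] b assms(2) by (cases "c = b") (simp_all add: fun_det_def)
    moreover have "(\<Sum>a<N. cofactor ?A a c * m a b) = (\<Sum>a<N. fun_cofactor N m a c * m a b)"
      using cof assms(2) by (intro sum.cong) auto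
    ultimately show ?thesis by simp
  qed
  have "(\<Sum>a<N. fun_cofactor N m a c * v a) = (\<Sum>a<N. \<Sum>b<N. fun_cofactor N m a c * m a b * u b)"
    by (intro sum.cong refl) (simp add: assms(1)[symmetric] sum_distrib_left mult.assoc)
  also have "\<dots> = (\<Sum>b<N. \<Sum>a<N. fun_cofactor N m a c * m a b * u b)" by (rule sum.swap)
  also have "\<dots> = (\<Sum>b<N. (\<Sum>a<N. fun_cofactor N m a c * m a b) * u b)"
    by (simp add: sum_distrib_right)
  also have "\<dots> = (\<Sum>b<N. if c = b then fun_det N m * u b else 0)"
    by (intro sum.cong refl) (simp add: inv)
  also have "\<dots> = fun_det N m * u c" using assms(2) by simp
  finally show ?thesis by simp
qed

lemma holomorphic_on_fun_det:
  assumes "\<And>a b. a < N \<Longrightarrow> b < N \<Longrightarrow> (\<lambda>w. m w a b) holomorphic_on S"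
  shows "(\<lambda>w. fun_det N (m w)) holomorphic_on S"
  unfolding fun_det_expand
  by (intro holomorphic_intros assms) (auto dest: permutes_in_image)

lemma holomorphic_on_fun_cofactor:
  assumes "\<And>a b. a < N \<Longrightarrow> b < N \<Longrightarrow> (\<lambda>w. m w a b) holomorphic_on S"
  shows "(\<lambda>w. fun_cofactor N (m w) i j) holomorphic_on S"
  unfolding fun_cofactor_def
  by (intro holomorphic_intros holomorphic_on_fun_det assms) auto

lemma bounded_times_image:
  fixes f g :: "'a \<Rightarrow> complex"
  assumes "bounded (f ` S)" "bounded (g ` S)"
  shows "bounded ((\<lambda>x. f x * g x) ` S)"
proof -
  obtain a b where "\<And>x. x \<in> S \<Longrightarrow> norm (f x) \<le> a" "\<And>x. x \<in> S \<Longrightarrow> norm (g x) \<le> b"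
    using assms by (auto simp: bounded_iff)
  then have "norm (f x * g x) \<le> a * b" if "x \<in> S" for x
    using that unfolding norm_mult by (meson mult_mono' norm_ge_zero)
  then show ?thesis by (auto simp: bounded_iff)
qed

lemma uniform_limit_sum:
  fixes f :: "'i \<Rightarrow> 'k \<Rightarrow> 'a \<Rightarrow> complex"
  assumes "\<And>i. i \<in> I \<Longrightarrow> uniform_limit S (f i) (g i) F"
  shows "uniform_limit S (\<lambda>k x. \<Sum>i\<in>I. f i k x) (\<lambda>x. \<Sum>i\<in>I. g i x) F"
  using assms
  by (induction I rule: infinite_finite_induct) (auto intro!: uniform_limit_intros)

text \<open>Boundedness of the limit is carried through the induction, because a product of uniformly
convergent families need not converge uniformly when a limit is unbounded.\<close>

lemma uniform_limit_prod:
  fixes f :: "'i \<Rightarrow> 'k \<Rightarrow> 'a \<Rightarrow> complex"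
  assumes "\<And>i. i \<in> I \<Longrightarrow> uniform_limit S (f i) (g i) F" and "\<And>i. i \<in> I \<Longrightarrow> bounded (g i ` S)"
  shows "uniform_limit S (\<lambda>k x. \<Prod>i\<in>I. f i k x) (\<lambda>x. \<Prod>i\<in>I. g i x) F
         \<and> bounded ((\<lambda>x. \<Prod>i\<in>I. g i x) ` S)"
  using assms
proof (induction I rule: infinite_finite_induct)
  case (insert i I)
  have "bounded ((\<lambda>x. g i x * (\<Prod>i\<in>I. g i x)) ` S)"
    using insert.prems(2)[of i] insert.IH insert.prems bounded_times_image[of "g i" S] by auto
  then show ?case using insert by (auto intro!: uniform_lim_mult)
qed (auto intro: uniform_limit_const simp: bounded_iff)

lemma uniform_limit_fun_det:
  assumes "\<And>a b. a < N \<Longrightarrow> b < N \<Longrightarrow> uniform_limit S (\<lambda>k w. M k w a b) (\<lambda>w. m w a b) F"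
    and "\<And>a b. a < N \<Longrightarrow> b < N \<Longrightarrow> bounded ((\<lambda>w. m w a b) ` S)"
  shows "uniform_limit S (\<lambda>k w. fun_det N (M k w)) (\<lambda>w. fun_det N (m w)) F"
  unfolding fun_det_expand
proof (rule uniform_limit_sum)
  fix p assume "p \<in> {p. p permutes {0..<N}}"
  then have p: "p i < N" if "i < N" for i using that permutes_in_image[of p "{0..<N}" i] by auto
  have *: "uniform_limit S (\<lambda>k x. \<Prod>i = 0..<N. M k x i (p i)) (\<lambda>x. \<Prod>i = 0..<N. m x i (p i)) F
         \<and> bounded ((\<lambda>x. \<Prod>i = 0..<N. m x i (p i)) ` S)"
    by (rule uniform_limit_prod) (use assms p in auto)
  show "uniform_limit S (\<lambda>k w. signof p * (\<Prod>i = 0..<N. M k w i (p i)))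
       (\<lambda>w. signof p * (\<Prod>i = 0..<N. m w i (p i))) F"
    by (intro uniform_lim_mult uniform_limit_const) (use * in \<open>auto simp: bounded_iff\<close>)
qed

section \<open>Operators on a weighted sequence space\<close>

text \<open>The theory below works with the explicit estimate \<open>\<bar>f\<bar> \<le> c V\<close> (\<open>dominated c f\<close>)
instead of a normed type: the weight is a parameter, and the operators are only meaningful on
sequences that satisfy such an estimate.\<close>

type_synonym operator = "(nat \<Rightarrow> complex) \<Rightarrow> nat \<Rightarrow> complex"

definition neumann :: "operator \<Rightarrow> complex \<Rightarrow> operator" where
  "neumann T w f = (\<lambda>i. \<Sum>n. w ^ n * (T ^^ n) f i)"

locale weight =
  fixes V :: "nat \<Rightarrow> real"
  assumes V_pos: "0 < V n"
begin

abbreviation W :: "(nat \<Rightarrow> complex) set" where "W \<equiv> weighted_space V"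

definition dominated :: "real \<Rightarrow> (nat \<Rightarrow> complex) \<Rightarrow> bool" where
  "dominated c f \<longleftrightarrow> (\<forall>i. cmod (f i) \<le> c * V i)"

lemma dominatedI: "(\<And>i. cmod (f i) \<le> c * V i) \<Longrightarrow> dominated c f"
  and dominatedD: "dominated c f \<Longrightarrow> cmod (f i) \<le> c * V i"
  by (auto simp: dominated_def)

lemma dominated_nonneg: "dominated c f \<Longrightarrow> 0 \<le> c"
  using dominatedD[of c f 0] V_pos[of 0] norm_ge_zero[of "f 0"]
  by (meson order_trans zero_le_mult_iff less_le_not_le)

lemma dominated_mono: "dominated c f \<Longrightarrow> c \<le> d \<Longrightarrow> dominated d f"
  using V_pos unfolding dominated_def by (meson less_imp_le mult_right_mono order_trans)

lemma inverse_weight_le_iff: "inverse (V n) * cmod z \<le> c \<longleftrightarrow> cmod z \<le> c * V n"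
  using V_pos[of n] by (simp add: field_simps)

lemma W_iff: "f \<in> W \<longleftrightarrow> (\<exists>c. dominated c f)"
  unfolding weighted_space_def bdd_above_def dominated_def by (auto simp: inverse_weight_le_iff)

lemma dominated_W: "dominated c f \<Longrightarrow> f \<in> W"
  using W_iff by blast

lemma W_dominated_norm: "f \<in> W \<Longrightarrow> dominated (weighted_norm V f) f"
  unfolding weighted_norm_def
  by (auto simp: weighted_space_def intro!: dominatedI cSUP_upper simp flip: inverse_weight_le_iff)

lemma weighted_norm_le: "dominated c f \<Longrightarrow> weighted_norm V f \<le> c"
  unfolding weighted_norm_def
  by (rule cSUP_least) (auto simp: inverse_weight_le_iff dest: dominatedD)

lemma dominated_add: "dominated c f \<Longrightarrow> dominated d g \<Longrightarrow> dominated (c + cmod a * d) (\<lambda>i. f i + a * g i)"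
proof (rule dominatedI)
  fix i assume fg: "dominated c f" "dominated d g"
  have "cmod (f i + a * g i) \<le> cmod (f i) + cmod a * cmod (g i)"
    by (metis norm_mult norm_triangle_ineq)
  also have "\<dots> \<le> c * V i + cmod a * (d * V i)"
    using fg by (intro add_mono mult_left_mono dominatedD) auto
  finally show "cmod (f i + a * g i) \<le> (c + cmod a * d) * V i" by (simp add: algebra_simps)
qed

lemma W_add: "f \<in> W \<Longrightarrow> g \<in> W \<Longrightarrow> (\<lambda>i. f i + a * g i) \<in> W"
  using dominated_add W_iff by meson

lemma dominated_0: "dominated 0 (\<lambda>_. 0)"
  by (simp add: dominated_def)

lemma W_0: "(\<lambda>_. 0) \<in> W"
  using dominated_0 dominated_W by blast

lemma const_W: assumes "\<And>i. V 0 \<le> V i" shows "(\<lambda>_. a) \<in> W"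
  using assms V_pos[of 0]
    by (intro dominated_W[of "cmod a / V 0"] dominatedI) (simp add: field_simps mult_left_mono)

lemma W_sum: "(\<And>b. b \<in> I \<Longrightarrow> g b \<in> W) \<Longrightarrow> (\<lambda>i. \<Sum>b\<in>I. a b * g b i) \<in> W"
proof (induction I rule: infinite_finite_induct)
  case (insert b I)
  then show ?case using W_add[of "\<lambda>i. \<Sum>b\<in>I. a b * g b i" "g b" "a b"] by (simp add: add.commute)
qed (auto simp: W_0)

text \<open>Continuous linear functionals on the weighted space. An operator on sequences is treated
coordinatewise, as a family of such functionals: the coordinate \<open>i\<close> of a bounded operator has
norm at most a constant times \<open>V i\<close>, and the constant may be improved for large \<open>i\<close>.\<close>

definition bounded_functional :: "real \<Rightarrow> ((nat \<Rightarrow> complex) \<Rightarrow> complex) \<Rightarrow> bool" where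
  "bounded_functional K \<phi> \<longleftrightarrow> (\<forall>f\<in>W. \<forall>g\<in>W. \<forall>a. \<phi> (\<lambda>i. f i + a * g i) = \<phi> f + a * \<phi> g)
     \<and> (\<forall>c f. dominated c f \<longrightarrow> cmod (\<phi> f) \<le> c * K)"

lemma bounded_functionalI:
  assumes "\<And>f g a. f \<in> W \<Longrightarrow> g \<in> W \<Longrightarrow> \<phi> (\<lambda>i. f i + a * g i) = \<phi> f + a * \<phi> g"
    and "\<And>c f. dominated c f \<Longrightarrow> cmod (\<phi> f) \<le> c * K"
  shows "bounded_functional K \<phi>"
  using assms unfolding bounded_functional_def by blast

lemma bounded_functional_add: "bounded_functional K \<phi> \<Longrightarrow> f \<in> W \<Longrightarrow> g \<in> W \<Longrightarrow> \<phi> (\<lambda>i. f i + a * g i) = \<phi> f + a * \<phi> g"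
  and bounded_functional_bound: "bounded_functional K \<phi> \<Longrightarrow> dominated c f \<Longrightarrow> cmod (\<phi> f) \<le> c * K"
  unfolding bounded_functional_def by blast+

lemma bounded_functional_0: "bounded_functional K \<phi> \<Longrightarrow> \<phi> (\<lambda>_. 0) = 0"
  using bounded_functional_bound[OF _ dominated_0] by simp

lemma bounded_functional_mult: "bounded_functional K \<phi> \<Longrightarrow> g \<in> W \<Longrightarrow> \<phi> (\<lambda>i. a * g i) = a * \<phi> g"
  using bounded_functional_add[OF _ W_0, of K \<phi> g a] bounded_functional_0[of K \<phi>] by simp

lemma bounded_functional_diff: "bounded_functional K \<phi> \<Longrightarrow> f \<in> W \<Longrightarrow> g \<in> W \<Longrightarrow> \<phi> (\<lambda>i. f i - g i) = \<phi> f - \<phi> g"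
  using bounded_functional_add[of K \<phi> f g "-1"] by simp

lemma bounded_functional_sum: 
  assumes "bounded_functional K \<phi>" "\<And>b. b \<in> I \<Longrightarrow> g b \<in> W"
  shows "\<phi> (\<lambda>i. \<Sum>b\<in>I. a b * g b i) = (\<Sum>b\<in>I. a b * \<phi> (g b))"
  using assms(2)
proof (induction I rule: infinite_finite_induct)
  case (insert b I)
  then show ?case
    using bounded_functional_add[OF assms(1), of "\<lambda>i. \<Sum>b\<in>I. a b * g b i" "g b" "a b"] W_sum[of I g a]
    by (simp add: add.commute)
qed (use bounded_functional_0[OF assms(1)] in auto)

text \<open>A continuous functional commutes with an absolutely convergent series. This one fact replaces
completeness of the weighted space: all infinite sums of sequences below are pointwise sums with a
summable sequence of bounds.\<close>

lemma bounded_functional_series: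
  assumes "bounded_functional K \<phi>" "\<And>n. dominated (c n) (f n)" "summable c"
  shows "dominated (suminf c) (\<lambda>i. \<Sum>n. f n i)" and "(\<lambda>n. \<phi> (f n)) sums \<phi> (\<lambda>i. \<Sum>n. f n i)"
proof -
  have sV: "summable (\<lambda>n. c (n + m) * V i)" for m i
    using assms(3) by (intro summable_mult2) (simp add: summable_iff_shift)
  have sn: "summable (\<lambda>n. norm (f (n + m) i))" for m i
    by (rule summable_comparison_test'[OF sV[of m i], of 0]) (use dominatedD[OF assms(2)] in auto)
  have tail: "dominated (\<Sum>n. c (n + m)) (\<lambda>i. \<Sum>n. f (n + m) i)" for m
  proof (rule dominatedI)
    fix i
    have "cmod (\<Sum>n. f (n + m) i) \<le> (\<Sum>n. norm (f (n + m) i))" by (rule summable_norm[OF sn])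
    also have "\<dots> \<le> (\<Sum>n. c (n + m) * V i)" by (intro suminf_le sn sV dominatedD assms(2))
    also have "\<dots> = (\<Sum>n. c (n + m)) * V i"
      using assms(3) by (intro suminf_mult2[symmetric]) (simp add: summable_iff_shift)
    finally show "cmod (\<Sum>n. f (n + m) i) \<le> (\<Sum>n. c (n + m)) * V i" .
  qed
  show D: "dominated (suminf c) (\<lambda>i. \<Sum>n. f n i)" using tail[of 0] by simp
  have sf: "summable (\<lambda>n. f n i)" for i using summable_norm_cancel[OF sn[of 0 i]] by simp
  have eq: "\<phi> (\<lambda>i. \<Sum>n. f n i) - (\<Sum>n<m. \<phi> (f n)) = \<phi> (\<lambda>i. \<Sum>n. f (n + m) i)" for m
  proof -
    have "\<phi> (\<lambda>i. \<Sum>n<m. 1 * f n i) = (\<Sum>n<m. 1 * \<phi> (f n))"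
      by (rule bounded_functional_sum[OF assms(1)]) (rule dominated_W[OF assms(2)])
    moreover have "(\<lambda>i. \<Sum>n<m. 1 * f n i) \<in> W" by (rule W_sum) (rule dominated_W[OF assms(2)])
    ultimately have "\<phi> (\<lambda>i. \<Sum>n. f n i) - (\<Sum>n<m. \<phi> (f n))
        = \<phi> (\<lambda>i. (\<Sum>n. f n i) - (\<Sum>n<m. f n i))"
      using bounded_functional_diff[OF assms(1) dominated_W[OF D], of "\<lambda>i. \<Sum>n<m. f n i"] by simp
    also have "(\<lambda>i. (\<Sum>n. f n i) - (\<Sum>n<m. f n i)) = (\<lambda>i. \<Sum>n. f (n + m) i)"
      by (simp add: suminf_minus_initial_segment[OF sf])
    finally show ?thesis .
  qed
  have "(\<lambda>m. \<phi> (\<lambda>i. \<Sum>n. f n i) - (\<Sum>n<m. \<phi> (f n))) \<longlonglongrightarrow> 0"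
  proof (rule tendsto_0_le)
    show "(\<lambda>m. \<Sum>n. c (n + m)) \<longlonglongrightarrow> 0" by (rule suminf_exist_split2[OF assms(3)])
    show "\<forall>\<^sub>F m in sequentially. norm (\<phi> (\<lambda>i. \<Sum>n. f n i) - (\<Sum>n<m. \<phi> (f n)))
        \<le> norm (\<Sum>n. c (n + m)) * K"
    proof (rule always_eventually, rule allI)
      fix m
      have "cmod (\<phi> (\<lambda>i. \<Sum>n. f (n + m) i)) \<le> (\<Sum>n. c (n + m)) * K"
        by (rule bounded_functional_bound[OF assms(1) tail])
      then show "norm (\<phi> (\<lambda>i. \<Sum>n. f n i) - (\<Sum>n<m. \<phi> (f n))) \<le> norm (\<Sum>n. c (n + m)) * K"
        using dominated_nonneg[OF tail] unfolding eq by simp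
    qed
  qed
  then show "(\<lambda>n. \<phi> (f n)) sums \<phi> (\<lambda>i. \<Sum>n. f n i)"
    unfolding sums_def using tendsto_diff[OF tendsto_const, of _ 0 sequentially "\<phi> (\<lambda>i. \<Sum>n. f n i)"]
      by fastforce
qed

lemma bounded_functional_eval: "bounded_functional (V i) (\<lambda>f. f i)"
  by (auto simp: bounded_functional_def dominated_def)

definition bounded_op :: "real \<Rightarrow> operator \<Rightarrow> bool" where
  "bounded_op q T \<longleftrightarrow> 0 \<le> q \<and> (\<forall>i. bounded_functional (q * V i) (\<lambda>f. T f i))"

lemma bounded_op_bounded_functional: "bounded_op q T \<Longrightarrow> bounded_functional (q * V i) (\<lambda>f. T f i)"
  by (simp add: bounded_op_def)

lemma bounded_op_dominated: "bounded_op q T \<Longrightarrow> dominated c f \<Longrightarrow> dominated (c * q) (T f)"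
  using bounded_functional_bound[OF bounded_op_bounded_functional]
    by (intro dominatedI) (simp add: mult.assoc)

lemma bounded_op_W: "bounded_op q T \<Longrightarrow> f \<in> W \<Longrightarrow> T f \<in> W"
  using bounded_op_dominated W_iff by meson

lemma bounded_op_pow_dominated: "bounded_op q T \<Longrightarrow> dominated c f \<Longrightarrow> dominated (c * q ^ n) ((T ^^ n) f)"
proof (induction n)
  case (Suc n)
  then show ?case using bounded_op_dominated[of q T "c * q ^ n" "(T ^^ n) f"] by (simp add: mult_ac)
qed simp

context
  fixes T q w
  assumes T: "bounded_op q T" and w: "cmod w * q < 1"
begin

lemma geometric_summable: "summable (\<lambda>n. c * (cmod w * q) ^ n)"
  using T w by (intro summable_mult summable_geometric) (simp add: bounded_op_def)

lemma neumann_term_dominated: "dominated c f \<Longrightarrow> dominated (c * (cmod w * q) ^ n) (\<lambda>i. w ^ n * (T ^^ n) f i)"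
  using dominated_add[OF dominated_0 bounded_op_pow_dominated[OF T, of c f n], of "w ^ n"]
  by (simp add: norm_power power_mult_distrib mult_ac)

lemma neumann_dominated: assumes "dominated c f"
  shows "dominated (c / (1 - cmod w * q)) (neumann T w f)"
proof -
  have "(\<Sum>n. c * (cmod w * q) ^ n) = c / (1 - cmod w * q)"
    using T w by (subst suminf_mult) (auto simp: suminf_geometric bounded_op_def)
  then show ?thesis
    using bounded_functional_series(1)[OF bounded_op_bounded_functional[OF T] neumann_term_dominated[OF assms] geometric_summable]
    by (simp add: neumann_def)
qed

lemma neumann_W: "f \<in> W \<Longrightarrow> neumann T w f \<in> W"
  using neumann_dominated W_iff by meson

lemma neumann_sums:
  assumes "bounded_functional K \<phi>" "f \<in> W"
  shows "(\<lambda>n. w ^ n * \<phi> ((T ^^ n) f)) sums \<phi> (neumann T w f)"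
proof -
  obtain c where c: "dominated c f" using assms(2) W_iff by blast
  have "\<phi> (\<lambda>i. w ^ n * (T ^^ n) f i) = w ^ n * \<phi> ((T ^^ n) f)" for n
    by (rule bounded_functional_mult[OF assms(1) dominated_W[OF bounded_op_pow_dominated[OF T c]]])
  then show ?thesis
    using bounded_functional_series(2)[OF assms(1) neumann_term_dominated[OF c] geometric_summable]
    by (simp add: neumann_def)
qed

text \<open>The Neumann series inverts \<open>1 - w T\<close> as long as \<open>\<bar>w\<bar>\<close> times the bound of \<open>T\<close> is below one.\<close>

lemma neumann_eq:
  assumes "f \<in> W"
  shows "neumann T w f i = f i + w * T (neumann T w f) i"
proof -
  have "(\<lambda>n. w ^ n * (T ^^ n) f i) sums neumann T w f i"
    by (rule neumann_sums[OF bounded_functional_eval assms])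
  then have "(\<lambda>n. w ^ Suc n * (T ^^ Suc n) f i) sums (neumann T w f i - f i)"
    using sums_Suc_iff[of "\<lambda>n. w ^ n * (T ^^ n) f i" "neumann T w f i - f i"] by simp
  moreover have "(\<lambda>n. w * (w ^ n * T ((T ^^ n) f) i)) sums (w * T (neumann T w f) i)"
    by (rule sums_mult[OF neumann_sums[OF bounded_op_bounded_functional[OF T] assms]])
  ultimately have "neumann T w f i - f i = w * T (neumann T w f) i"
    by (intro sums_unique2) (auto simp: mult.assoc)
  then show ?thesis by (simp add: algebra_simps)
qed

text \<open>The difference \<open>d\<close> of two solutions satisfies \<open>d = w T d\<close>, so its bound shrinks by the
factor \<open>\<bar>w\<bar> q < 1\<close> as often as desired.\<close>

lemma neumann_unique:
  assumes "f \<in> W" "g \<in> W" "\<And>i. g i = f i + w * T g i"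
  shows "g = neumann T w f"
proof -
  let ?d = "\<lambda>i. g i - neumann T w f i"
  have d: "?d i = w * T ?d i" for i
  proof -
    have "T ?d i = T g i - T (neumann T w f) i"
      by (rule bounded_functional_diff[OF bounded_op_bounded_functional[OF T] assms(2) neumann_W[OF assms(1)]])
    then have "w * T ?d i = w * T g i - w * T (neumann T w f) i" by (simp add: right_diff_distrib)
    moreover have "neumann T w f i = f i + w * T (neumann T w f) i"
      by (rule neumann_eq[OF assms(1)])
    moreover have "x = f i + w * x' \<Longrightarrow> y = f i + w * y' \<Longrightarrow> z = w * x' - w * y' \<Longrightarrow> x - y = z" for x y x' y' z
      by simp
    ultimately show ?thesis using assms(3)[of i] by blast
  qed
  have "?d \<in> W" using W_add[OF assms(2) neumann_W[OF assms(1)], of "-1"] by simp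
  then obtain c where c: "dominated c ?d" using W_iff by blast
  have "dominated (c * (cmod w * q) ^ n) ?d" for n
  proof (induction n)
    case (Suc n)
    have "dominated (cmod w * (c * (cmod w * q) ^ n * q)) (\<lambda>i. w * T ?d i)"
      using dominated_add[OF dominated_0 bounded_op_dominated[OF T Suc], of w] by simp
    moreover have "(\<lambda>i. w * T ?d i) = ?d" by (rule ext) (rule d[symmetric])
    ultimately show ?case by (simp add: mult_ac)
  qed (use c in simp)
  then have "cmod (?d i) \<le> c * (cmod w * q) ^ n * V i" for n i by (rule dominatedD)
  moreover have "(\<lambda>n. c * (cmod w * q) ^ n * V i) \<longlonglongrightarrow> 0" for i
    using tendsto_mult_left_zero[OF summable_LIMSEQ_zero[OF geometric_summable]] .
  ultimately have "cmod (?d i) \<le> 0" for i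
    by (meson LIMSEQ_le_const)
  then show ?thesis by auto
qed

text \<open>Linearity is read off from uniqueness, since the right-hand side solves the equation that
characterises the left-hand side.\<close>

lemma neumann_add:
  assumes "f \<in> W" "g \<in> W"
  shows "neumann T w (\<lambda>i. f i + a * g i) = (\<lambda>i. neumann T w f i + a * neumann T w g i)"
proof (rule neumann_unique[symmetric])
  show "(\<lambda>i. f i + a * g i) \<in> W" by (rule W_add[OF assms])
  show "(\<lambda>i. neumann T w f i + a * neumann T w g i) \<in> W" by (intro W_add neumann_W assms)
  show "neumann T w f i + a * neumann T w g i
      = f i + a * g i + w * T (\<lambda>i. neumann T w f i + a * neumann T w g i) i" for i
  proof -
    have "T (\<lambda>i. neumann T w f i + a * neumann T w g i) i = T (neumann T w f) i + a * T (neumann T w g) i"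
      by (rule bounded_functional_add[OF bounded_op_bounded_functional[OF T] neumann_W[OF assms(1)] neumann_W[OF assms(2)]])
    moreover have "neumann T w f i = f i + w * T (neumann T w f) i"
      by (rule neumann_eq[OF assms(1)])
    moreover have "neumann T w g i = g i + w * T (neumann T w g) i"
      by (rule neumann_eq[OF assms(2)])
    moreover have "x = f i + w * x' \<Longrightarrow> y = g i + w * y' \<Longrightarrow> z = x' + a * y'
        \<Longrightarrow> x + a * y = f i + a * g i + w * z" for x y x' y' z
      by (simp add: algebra_simps)
    ultimately show ?thesis by blast
  qed
qed

lemma neumann_bounded_functional: "bounded_functional (V i / (1 - cmod w * q)) (\<lambda>f. neumann T w f i)"
proof (rule bounded_functionalI)
  fix c f assume "dominated c f"
  then show "cmod (neumann T w f i) \<le> c * (V i / (1 - cmod w * q))"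
    using dominatedD[OF neumann_dominated, of c f i] by simp
qed (simp only: neumann_add)

end

lemma neumann_holomorphic:
  assumes "bounded_op q T" "0 < q" "bounded_functional K \<phi>" "f \<in> W"
  shows "(\<lambda>w. \<phi> (neumann T w f)) holomorphic_on ball 0 (1 / q)"
proof (rule power_series_holomorphic[where a = "\<lambda>n. \<phi> ((T ^^ n) f)"])
  fix w assume "w \<in> ball (0 :: complex) (1 / q)"
  then have "cmod w * q < 1" using assms(2) by (simp add: field_simps)
  then show "(\<lambda>n. \<phi> ((T ^^ n) f) * (w - 0) ^ n) sums \<phi> (neumann T w f)"
    using neumann_sums[OF assms(1) _ assms(3,4)] by (simp add: mult.commute)
qed

end

section \<open>Finite-rank perturbations and their determinant\<close>

text \<open>\<open>perturbed T N l h\<close> is \<open>T\<close> plus an operator of rank at most \<open>N\<close>. If \<open>T\<close> has bound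
\<open>r\<close>, then for \<open>\<bar>w\<bar> r < 1\<close> the equation \<open>g = f + w (perturbed T N l h) g\<close> is solved for \<open>g\<close> by
the Neumann series of \<open>T\<close> once the \<open>N\<close> numbers \<open>l a g\<close> are known, and these numbers
satisfy a linear system with matrix \<open>reduced_matrix T l h w\<close>. Its determinant is a holomorphic function
of \<open>w\<close> that plays the role of a characteristic polynomial for \<open>1 / w\<close> outside the disc of radius
\<open>r\<close>. The variable \<open>w = 1 / z\<close> is used rather than the spectral parameter \<open>z\<close>, because then the
domain is a disc and the value at its centre is 1.\<close>

definition perturbed :: "operator \<Rightarrow> nat \<Rightarrow> (nat \<Rightarrow> (nat \<Rightarrow> complex) \<Rightarrow> complex)
    \<Rightarrow> (nat \<Rightarrow> nat \<Rightarrow> complex) \<Rightarrow> operator" where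
  "perturbed T N l h f = (\<lambda>i. T f i + (\<Sum>a<N. l a f * h a i))"

definition reduced_matrix :: "operator \<Rightarrow> (nat \<Rightarrow> (nat \<Rightarrow> complex) \<Rightarrow> complex)
    \<Rightarrow> (nat \<Rightarrow> nat \<Rightarrow> complex) \<Rightarrow> complex \<Rightarrow> nat \<Rightarrow> nat \<Rightarrow> complex" where
  "reduced_matrix T l h w a b = (if a = b then 1 else 0) - w * l a (neumann T w (h b))"

definition reduced_det :: "operator \<Rightarrow> nat \<Rightarrow> (nat \<Rightarrow> (nat \<Rightarrow> complex) \<Rightarrow> complex)
    \<Rightarrow> (nat \<Rightarrow> nat \<Rightarrow> complex) \<Rightarrow> complex \<Rightarrow> complex" where
  "reduced_det T N l h w = fun_det N (reduced_matrix T l h w)"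

lemma reduced_det_0: "reduced_det T N l h 0 = 1"
proof -
  have "mat N N (\<lambda>(a, b). reduced_matrix T l h 0 a b) = 1\<^sub>m N"
    by (intro eq_matI) (auto simp: reduced_matrix_def)
  then show ?thesis by (simp add: reduced_det_def fun_det_def)
qed

context weight
begin

context
  fixes T r and N :: nat and l h K H
  assumes T: "bounded_op r T" and r: "0 < r"
    and l: "\<And>a. a < N \<Longrightarrow> bounded_functional K (l a)" and h: "\<And>a. a < N \<Longrightarrow> dominated H (h a)"
begin

lemma reduced_matrix_holomorphic:
  assumes "a < N" "b < N"
  shows "(\<lambda>w. reduced_matrix T l h w a b) holomorphic_on ball 0 (1 / r)"
  unfolding reduced_matrix_def
  by (intro holomorphic_intros neumann_holomorphic[OF T r l dominated_W[OF h]] assms)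

lemma reduced_det_holomorphic: "reduced_det T N l h holomorphic_on ball 0 (1 / r)"
  unfolding reduced_det_def[abs_def] by (intro holomorphic_on_fun_det reduced_matrix_holomorphic)

lemma reduced_matrix_mult:
  assumes "a < N"
  shows "(\<Sum>b<N. reduced_matrix T l h w a b * u b) = u a - (\<Sum>b<N. w * u b * l a (neumann T w (h b)))"
proof -
  have "(\<Sum>b<N. reduced_matrix T l h w a b * u b)
      = (\<Sum>b<N. (if a = b then u b else 0) - w * u b * l a (neumann T w (h b)))"
    by (intro sum.cong refl) (simp add: reduced_matrix_def algebra_simps)
  also have "\<dots> = u a - (\<Sum>b<N. w * u b * l a (neumann T w (h b)))"
    using assms by (simp add: sum_subtractf)
  finally show ?thesis .
qed

lemma perturbed_split: "f i + w * perturbed T N l h g i = (f i + (\<Sum>b<N. (w * l b g) * h b i)) + w * T g i"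
  by (simp add: perturbed_def algebra_simps sum_distrib_left)

lemma h_comb_W: "(\<lambda>i. \<Sum>b<N. u b * h b i) \<in> W"
  by (rule W_sum) (use h dominated_W in auto)

context
  fixes w assumes w: "cmod w * r < 1"
begin

lemma neumann_comb:
  assumes "f \<in> W"
  shows "neumann T w (\<lambda>i. f i + (\<Sum>b<N. u b * h b i)) i = neumann T w f i + (\<Sum>b<N. u b * neumann T w (h b) i)"
proof -
  have "neumann T w (\<lambda>i. f i + 1 * (\<Sum>b<N. u b * h b i)) i
      = neumann T w f i + 1 * neumann T w (\<lambda>i. \<Sum>b<N. u b * h b i) i"
    by (rule bounded_functional_add[OF neumann_bounded_functional[OF T w] assms h_comb_W])
  also have "neumann T w (\<lambda>i. \<Sum>b<N. u b * h b i) i = (\<Sum>b<N. u b * neumann T w (h b) i)"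
    using h dominated_W
      by (intro bounded_functional_sum[OF neumann_bounded_functional[OF T w]]) auto
  finally show ?thesis by simp
qed

text \<open>Moving the finite-rank part to the right-hand side turns the equation for \<open>g\<close> into one for
\<open>T\<close> alone; applying the functionals \<open>l a\<close> to its solution gives the linear system.\<close>

lemma perturbed_resolvent:
  assumes "f \<in> W" "g \<in> W" "\<And>i. g i = f i + w * perturbed T N l h g i"
  shows "g = (\<lambda>i. neumann T w f i + (\<Sum>b<N. (w * l b g) * neumann T w (h b) i))"
    and "a < N \<Longrightarrow> (\<Sum>b<N. reduced_matrix T l h w a b * l b g) = l a (neumann T w f)"
proof -
  let ?f = "\<lambda>i. f i + (\<Sum>b<N. (w * l b g) * h b i)"
  have "?f \<in> W" using W_add[OF assms(1) h_comb_W, of 1 "\<lambda>b. w * l b g"] by simp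
  then have "g = neumann T w ?f"
    by (rule neumann_unique[OF T w _ assms(2)]) (use assms(3) in \<open>simp only: perturbed_split[symmetric]\<close>)
  also have "\<dots> = (\<lambda>i. neumann T w f i + (\<Sum>b<N. (w * l b g) * neumann T w (h b) i))"
    by (rule ext) (rule neumann_comb[OF assms(1)])
  finally show *: "g = (\<lambda>i. neumann T w f i + (\<Sum>b<N. (w * l b g) * neumann T w (h b) i))" .
  assume a: "a < N"
  have nh: "neumann T w (h b) \<in> W" if "b < N" for b
    using that neumann_W[OF T w dominated_W[OF h]] by blast
  have "l a g = l a (\<lambda>i. neumann T w f i + 1 * (\<Sum>b<N. (w * l b g) * neumann T w (h b) i))"
    by (subst *) simp
  also have "\<dots> = l a (neumann T w f) + 1 * l a (\<lambda>i. \<Sum>b<N. (w * l b g) * neumann T w (h b) i)"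
    using nh by (intro bounded_functional_add[OF l[OF a]] neumann_W[OF T w assms(1)] W_sum) auto
  also have "l a (\<lambda>i. \<Sum>b<N. (w * l b g) * neumann T w (h b) i)
      = (\<Sum>b<N. (w * l b g) * l a (neumann T w (h b)))"
    using nh by (intro bounded_functional_sum[OF l[OF a]]) auto
  finally show "(\<Sum>b<N. reduced_matrix T l h w a b * l b g) = l a (neumann T w f)"
    by (simp add: reduced_matrix_mult[OF a])
qed

text \<open>A kernel vector \<open>u\<close> of the reduced matrix gives the eigenfunction: it is the Neumann solution with
the finite-rank part prescribed by \<open>u\<close>, and the linear system says that this prescription is
consistent. The function is not zero because the \<open>u a\<close> are recovered as its values under \<open>l a\<close>.\<close>

lemma eigenfunction_of_reduced_det_zero:
  assumes "reduced_det T N l h w = 0"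
  obtains g where "g \<in> W" "g \<noteq> (\<lambda>_. 0)" "\<And>i. g i = w * perturbed T N l h g i"
proof -
  obtain u where u0: "\<exists>a<N. u a \<noteq> 0" and u: "\<And>a. a < N \<Longrightarrow> (\<Sum>b<N. reduced_matrix T l h w a b * u b) = 0"
    using assms unfolding reduced_det_def fun_det_eq_0_iff by blast
  define g where "g = (\<lambda>i. \<Sum>b<N. (w * u b) * neumann T w (h b) i)"
  have nh: "neumann T w (h b) \<in> W" if "b < N" for b
    using that neumann_W[OF T w dominated_W[OF h]] by blast
  have gW: "g \<in> W" unfolding g_def using nh by (intro W_sum) auto
  have lg: "l a g = u a" if "a < N" for a
  proof -
    have "l a g = (\<Sum>b<N. (w * u b) * l a (neumann T w (h b)))"
      unfolding g_def using nh by (intro bounded_functional_sum[OF l[OF that]]) auto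
    then show ?thesis using u[OF that] by (simp add: reduced_matrix_mult[OF that])
  qed
  have eq: "g i = w * perturbed T N l h g i" for i
  proof -
    have "g i = (\<Sum>b<N. (w * u b) * (h b i + w * T (neumann T w (h b)) i))"
      unfolding g_def using neumann_eq[OF T w dominated_W[OF h]] by (intro sum.cong) auto
    also have "\<dots> = (\<Sum>b<N. (w * l b g) * h b i) + w * (\<Sum>b<N. (w * u b) * T (neumann T w (h b)) i)"
      by (simp add: lg sum_distrib_left distrib_left sum.distrib mult_ac)
    also have "(\<Sum>b<N. (w * u b) * T (neumann T w (h b)) i) = T g i"
      unfolding g_def using nh
        by (intro bounded_functional_sum[OF bounded_op_bounded_functional[OF T], symmetric]) auto
    finally show ?thesis using perturbed_split[of "\<lambda>_. 0" i w g] by simp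
  qed
  have "g \<noteq> (\<lambda>_. 0)"
  proof
    assume "g = (\<lambda>_. 0)"
    then have "u a = 0" if "a < N" for a using lg[OF that] bounded_functional_0[OF l[OF that]]
      by simp
    then show False using u0 by blast
  qed
  then show ?thesis using that gW eq by blast
qed

lemma reduced_det_zero_of_eigenfunction:
  assumes "g \<in> W" "g \<noteq> (\<lambda>_. 0)" "\<And>i. g i = w * perturbed T N l h g i"
  shows "reduced_det T N l h w = 0"
proof -
  have eq: "g i = 0 + w * perturbed T N l h g i" for i using assms(3)[of i] by simp
  have n0: "neumann T w (\<lambda>_. 0) = (\<lambda>_. 0)"
    by (rule neumann_unique[OF T w W_0 W_0, symmetric]) (use bounded_functional_0[OF bounded_op_bounded_functional[OF T]] in simp)
  have g: "g i = (\<Sum>b<N. (w * l b g) * neumann T w (h b) i)" for i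
    using fun_cong[OF perturbed_resolvent(1)[OF W_0 assms(1) eq], of i] by (simp add: n0)
  have u: "(\<Sum>b<N. reduced_matrix T l h w a b * l b g) = 0" if "a < N" for a
    using perturbed_resolvent(2)[OF W_0 assms(1) eq that] bounded_functional_0[OF l[OF that]]
      by (simp add: n0)
  have "\<exists>a<N. l a g \<noteq> 0"
  proof (rule ccontr)
    assume "\<not> (\<exists>a<N. l a g \<noteq> 0)"
    then have "(\<Sum>b<N. (w * l b g) * neumann T w (h b) i) = 0" for i by (intro sum.neutral) auto
    then have "g i = 0" for i using g[of i] by simp
    then show False using assms(2) by auto
  qed
  then show ?thesis using u unfolding reduced_det_def fun_det_eq_0_iff
    by (intro exI[of _ "\<lambda>a. l a g"]) blast
qed

end

text \<open>A crude bound, needed only to know that the Neumann series of the perturbed operator converges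
for \<open>w\<close> near 0.\<close>

lemma perturbed_bounded_op: "bounded_op (r + real N * \<bar>K\<bar> * \<bar>H\<bar>) (perturbed T N l h)"
  unfolding bounded_op_def
proof (intro conjI allI bounded_functionalI)
  show "0 \<le> r + real N * \<bar>K\<bar> * \<bar>H\<bar>" using r by simp
next
  fix i f g a assume fg: "f \<in> W" "g \<in> W"
  show "perturbed T N l h (\<lambda>i. f i + a * g i) i = perturbed T N l h f i + a * perturbed T N l h g i"
    using bounded_functional_add[OF bounded_op_bounded_functional[OF T] fg] bounded_functional_add[OF l fg]
    by (simp add: perturbed_def distrib_left distrib_right sum.distrib sum_distrib_left mult.assoc)
next
  fix i c f assume f: "dominated c f"
  have "cmod (l a f * h a i) \<le> (c * \<bar>K\<bar>) * (\<bar>H\<bar> * V i)" if "a < N" for a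
  proof -
    have "cmod (l a f) \<le> c * \<bar>K\<bar>"
      using bounded_functional_bound[OF l[OF that] f] mult_left_mono[OF abs_ge_self[of K] dominated_nonneg[OF f]]
        by linarith
    moreover have "cmod (h a i) \<le> \<bar>H\<bar> * V i"
      using dominatedD[OF h[OF that], of i] mult_right_mono[OF abs_ge_self[of H] less_imp_le[OF V_pos[of i]]]
        by linarith
    ultimately show ?thesis unfolding norm_mult by (rule mult_mono') auto
  qed
  then have "cmod (\<Sum>a<N. l a f * h a i) \<le> real N * ((c * \<bar>K\<bar>) * (\<bar>H\<bar> * V i))"
    using sum_norm_le[of "{..<N}" "\<lambda>a. l a f * h a i" "\<lambda>_. (c * \<bar>K\<bar>) * (\<bar>H\<bar> * V i)"] by simp
  moreover have "cmod (T f i) \<le> c * r * V i" by (rule dominatedD[OF bounded_op_dominated[OF T f]])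
  ultimately show "cmod (perturbed T N l h f i) \<le> c * ((r + real N * \<bar>K\<bar> * \<bar>H\<bar>) * V i)"
    unfolding perturbed_def using norm_triangle_ineq[of "T f i" "\<Sum>a<N. l a f * h a i"]
    by (simp add: algebra_simps)
qed

text \<open>Absence of zeros of the determinant in a closed disc gives the geometric rate of decay of the
powers, with a constant that does not depend on the sequence. For small \<open>w\<close> the power
series with coefficients \<open>B ^ n f i\<close>, where \<open>B\<close> is the perturbed operator, is the resolvent,
and Cramer's rule expresses it through the Neumann series of \<open>T\<close> and the inverse of the
determinant. That expression is holomorphic and bounded up to radius \<open>1 / \<rho>\<close>, so Cauchy's
inequality bounds the coefficients.\<close>

theorem perturbed_power_bound:
  assumes \<rho>: "r < \<rho>" and nz: "\<And>w. cmod w \<le> 1 / \<rho> \<Longrightarrow> reduced_det T N l h w \<noteq> 0"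
  obtains C where "\<And>c f n. dominated c f \<Longrightarrow> dominated (c * C * \<rho> ^ n) ((perturbed T N l h ^^ n) f)"
proof -
  let ?B = "cball (0 :: complex) (1 / \<rho>)"
  have \<rho>0: "0 < \<rho>" using \<rho> r by simp
  have sub: "?B \<subseteq> ball 0 (1 / r)"
    using \<rho> r by (simp add: cball_subset_ball_iff frac_less2)
  have rw: "cmod w * r \<le> r / \<rho>" if "w \<in> ?B" for w
    using that r mult_right_mono[of "cmod w" "1 / \<rho>" r] by simp
  have r1: "r / \<rho> < 1" using \<rho> \<rho>0 by simp
  have hol_det: "reduced_det T N l h holomorphic_on ?B"
    by (rule holomorphic_on_subset[OF reduced_det_holomorphic sub])
  define cf where "cf = (\<lambda>a b w. fun_cofactor N (reduced_matrix T l h w) a b)"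
  have hol_cf: "cf a b holomorphic_on ?B" for a b
    unfolding cf_def
    by (rule holomorphic_on_subset[OF holomorphic_on_fun_cofactor sub]) (rule reduced_matrix_holomorphic)
  have "\<exists>Z. \<forall>w\<in>?B. cmod (cf a b w) \<le> Z" for a b
    using compact_imp_bounded[OF compact_continuous_image[OF holomorphic_on_imp_continuous_on[OF hol_cf]]]
    by (auto simp: bounded_iff)
  then obtain Z0 where Z0: "\<And>a b w. w \<in> ?B \<Longrightarrow> cmod (cf a b w) \<le> Z0 a b" by metis
  have "\<exists>Z. \<forall>w\<in>?B. cmod (inverse (reduced_det T N l h w)) \<le> Z"
    using compact_imp_bounded[OF compact_continuous_image[OF continuous_on_inverse[OF
      holomorphic_on_imp_continuous_on[OF hol_det]]]] nz
    by (auto simp: bounded_iff)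
  then obtain E where E: "\<And>w. w \<in> ?B \<Longrightarrow> cmod (inverse (reduced_det T N l h w)) \<le> E" by blast
  define G where "G = 1 / (1 - r / \<rho>)"
  have G0: "0 < G" using r1 by (simp add: G_def)
  have nG: "dominated (c * G) (neumann T w f)" if "dominated c f" "w \<in> ?B" for c f w
  proof (rule dominated_mono)
    show "dominated (c / (1 - cmod w * r)) (neumann T w f)"
      by (rule neumann_dominated[OF T _ that(1)]) (use rw[OF that(2)] r1 in simp)
    show "c / (1 - cmod w * r) \<le> c * G"
      using rw[OF that(2)] r1 dominated_nonneg[OF that(1)] unfolding G_def
      by (simp add: divide_left_mono)
  qed
  \<comment> \<open>The supremum bound of the closed form on the disc, per unit of \<open>c V i\<close>.\<close>
  define C where "C = G + 1 / \<rho> * E * (\<Sum>b<N. (\<Sum>a<N. Z0 a b * (G * K)) * (H * G))"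
  show ?thesis
  proof (rule that, rule dominatedI)
    fix c f n i assume f: "dominated c f"
    have fW: "f \<in> W" using f dominated_W by blast
    \<comment> \<open>The closed form of the resolvent at the coordinate \<open>i\<close>, meaningful on the whole disc.\<close>
    define R where "R = (\<lambda>w. neumann T w f i + w * inverse (reduced_det T N l h w) *
      (\<Sum>b<N. (\<Sum>a<N. cf a b w * l a (neumann T w f)) * neumann T w (h b) i))"
    have hol: "(\<lambda>w. \<phi> (neumann T w g)) holomorphic_on ?B"
      if "bounded_functional k \<phi>" "g \<in> W" for \<phi> k g
      by (rule holomorphic_on_subset[OF neumann_holomorphic[OF T r that] sub])
    have holR: "R holomorphic_on ?B"
      unfolding R_def using nz
      by (intro holomorphic_intros hol_det hol_cf hol[OF bounded_functional_eval] hol[OF l] fW dominated_W[OF h])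
         (auto simp: dist_norm)
    have bound: "cmod (R w) \<le> c * C * V i" if w: "w \<in> ?B" for w
    proof -
      have "cmod (cf a b w * l a (neumann T w f)) \<le> Z0 a b * (c * G * K)" if "a < N" for a b
        unfolding norm_mult
        using Z0[OF w] bounded_functional_bound[OF l[OF that] nG[OF f w]] by (intro mult_mono') auto
      then have "cmod (\<Sum>a<N. cf a b w * l a (neumann T w f)) \<le> (\<Sum>a<N. Z0 a b * (c * G * K))" for b
        by (intro sum_norm_le) auto
      then have "cmod ((\<Sum>a<N. cf a b w * l a (neumann T w f)) * neumann T w (h b) i)
          \<le> (\<Sum>a<N. Z0 a b * (c * G * K)) * (H * G * V i)" if "b < N" for b
        unfolding norm_mult using dominatedD[OF nG[OF h[OF that] w], of i]
          by (intro mult_mono') auto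
      then have "cmod (\<Sum>b<N. (\<Sum>a<N. cf a b w * l a (neumann T w f)) * neumann T w (h b) i)
          \<le> (\<Sum>b<N. (\<Sum>a<N. Z0 a b * (c * G * K)) * (H * G * V i))"
        by (intro sum_norm_le) auto
      moreover have "cmod (w * inverse (reduced_det T N l h w)) \<le> 1 / \<rho> * E"
        unfolding norm_mult using w E[OF w] by (intro mult_mono') auto
      ultimately have "cmod (w * inverse (reduced_det T N l h w)
          * (\<Sum>b<N. (\<Sum>a<N. cf a b w * l a (neumann T w f)) * neumann T w (h b) i))
          \<le> 1 / \<rho> * E * (\<Sum>b<N. (\<Sum>a<N. Z0 a b * (c * G * K)) * (H * G * V i))"
        unfolding norm_mult[of "w * inverse (reduced_det T N l h w)"] by (intro mult_mono') auto
      moreover have "cmod (neumann T w f i) \<le> c * G * V i" by (rule dominatedD[OF nG[OF f w]])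
      ultimately have "cmod (R w) \<le> c * G * V i
          + 1 / \<rho> * E * (\<Sum>b<N. (\<Sum>a<N. Z0 a b * (c * G * K)) * (H * G * V i))"
        unfolding R_def by (rule norm_triangle_le[OF add_mono, rotated])
      also have "\<dots> = c * C * V i"
        by (simp add: C_def algebra_simps sum_distrib_left sum_distrib_right)
      finally show ?thesis .
    qed
    let ?q = "r + real N * \<bar>K\<bar> * \<bar>H\<bar>"
    have q: "0 < ?q" "r \<le> ?q" using r by (auto intro: add_pos_nonneg)
    have series: "(\<lambda>n. (perturbed T N l h ^^ n) f i * w ^ n) sums R w"
      if w: "w \<in> ball 0 (1 / ?q)" "w \<in> ?B" for w
    proof -
      have wq: "cmod w * ?q < 1" using w(1) q by (simp add: field_simps)
      have wr: "cmod w * r < 1" using rw[OF w(2)] r1 by simp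
      define F where "F = neumann (perturbed T N l h) w f"
      have FW: "F \<in> W" unfolding F_def by (rule neumann_W[OF perturbed_bounded_op wq fW])
      have eq: "F i = f i + w * perturbed T N l h F i" for i
        unfolding F_def by (rule neumann_eq[OF perturbed_bounded_op wq fW])
      have D0: "reduced_det T N l h w \<noteq> 0" using nz w(2) by simp
      have u: "l b F = inverse (reduced_det T N l h w) * (\<Sum>a<N. cf a b w * l a (neumann T w f))"
        if "b < N" for b
        using fun_det_cramer[of N "reduced_matrix T l h w" "\<lambda>b. l b F" "\<lambda>a. l a (neumann T w f)", OF perturbed_resolvent(2)[OF wr fW FW eq] that]
          D0 by (simp add: cf_def reduced_det_def field_simps)
      have "F i = neumann T w f i + (\<Sum>b<N. (w * l b F) * neumann T w (h b) i)"
        using perturbed_resolvent(1)[OF wr fW FW eq] by metis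
      also have "\<dots> = R w"
        unfolding R_def sum_distrib_left
          by (intro arg_cong2[of _ _ _ _ "(+)"] sum.cong refl) (simp add: u mult_ac)
      finally show ?thesis
        using neumann_sums[OF perturbed_bounded_op wq bounded_functional_eval fW, of i]
          by (simp add: F_def mult.commute)
    qed
    have "R has_fps_expansion Abs_fps (\<lambda>n. (perturbed T N l h ^^ n) f i)"
    proof (rule has_fps_expansionI)
      have "eventually (\<lambda>w. w \<in> ball 0 (1 / ?q) \<inter> ball 0 (1 / \<rho>)) (nhds (0 :: complex))"
        using q \<rho>0 by (intro eventually_nhds_in_open) auto
      then show "eventually (\<lambda>w. (\<lambda>n. fps_nth (Abs_fps (\<lambda>n. (perturbed T N l h ^^ n) f i)) n * w ^ n) sums R w) (nhds 0)"
        by eventually_elim (use series in auto)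
    qed
    then have "cmod ((perturbed T N l h ^^ n) f i) = cmod ((deriv ^^ n) R 0) / fact n"
      using fps_nth_fps_expansion[of R _ n] by (fastforce simp: norm_divide)
    also have "\<dots> \<le> (fact n * (c * C * V i) / (1 / \<rho>) ^ n) / fact n"
    proof (intro divide_right_mono Cauchy_inequality)
      show "R holomorphic_on ball 0 (1 / \<rho>)" by (rule holomorphic_on_subset[OF holR]) auto
      show "continuous_on ?B R" by (rule holomorphic_on_imp_continuous_on[OF holR])
      show "0 < 1 / \<rho>" using \<rho>0 by simp
      show "cmod (R x) \<le> c * C * V i" if "cmod (0 - x) = 1 / \<rho>" for x
        using that by (intro bound) simp
    qed simp
    also have "\<dots> = c * C * \<rho> ^ n * V i" by (simp add: power_one_over)
    finally show "cmod ((perturbed T N l h ^^ n) f i) \<le> c * C * \<rho> ^ n * V i" .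
  qed
qed

end

text \<open>The coefficients of the entries, as power series in \<open>w\<close>, are values \<open>l a (T ^ n (h b))\<close>.
Each of them depends on finitely many applications of the operators and hence converges, and the
uniform bound \<open>r\<close> on all operators supplies the dominating geometric series for Tannery's
theorem. So pointwise convergence of the operators on bounded families is enough for
uniform convergence of the determinants on compact discs.\<close>

theorem reduced_det_uniform_limit:
  fixes N :: nat
  assumes Tk: "\<And>k. bounded_op r (Tk k)" and T: "bounded_op r T" and r: "0 < r"
    and lk: "\<And>k a. a < N \<Longrightarrow> bounded_functional K (lk k a)" and l: "\<And>a. a < N \<Longrightarrow> bounded_functional K (l a)"
    and h: "\<And>a. a < N \<Longrightarrow> dominated H (h a)"
    and convT: "\<And>c fk f i. (\<And>k. dominated c (fk k)) \<Longrightarrow> (\<And>i. (\<lambda>k. fk k i) \<longlonglongrightarrow> f i)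
      \<Longrightarrow> (\<lambda>k. Tk k (fk k) i) \<longlonglongrightarrow> T f i"
    and convl: "\<And>c fk f a. (\<And>k. dominated c (fk k)) \<Longrightarrow> (\<And>i. (\<lambda>k. fk k i) \<longlonglongrightarrow> f i)
      \<Longrightarrow> a < N \<Longrightarrow> (\<lambda>k. lk k a (fk k)) \<longlonglongrightarrow> l a f"
    and \<rho>: "r < \<rho>"
  shows "uniform_limit (cball 0 (1 / \<rho>)) (\<lambda>k. reduced_det (Tk k) N (lk k) h) (reduced_det T N l h) sequentially"
  unfolding reduced_det_def
proof (rule uniform_limit_fun_det)
  let ?B = "cball (0 :: complex) (1 / \<rho>)"
  have \<rho>0: "0 < \<rho>" using \<rho> r by simp
  have sub: "?B \<subseteq> ball 0 (1 / r)"
    using \<rho> r by (simp add: cball_subset_ball_iff frac_less2)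
  have wr: "cmod w * r < 1" if "w \<in> ?B" for w
    using subsetD[OF sub that] r by (simp add: field_simps)
  fix a b assume ab: "a < N" "b < N"
  have hW: "h b \<in> W" using dominated_W[OF h[OF ab(2)]] .
  show "bounded ((\<lambda>w. reduced_matrix T l h w a b) ` ?B)"
    by (intro compact_imp_bounded compact_continuous_image holomorphic_on_imp_continuous_on
        holomorphic_on_subset[OF reduced_matrix_holomorphic[OF T r l h ab] sub]) auto
  have "(\<lambda>k. (Tk k ^^ n) (h b) i) \<longlonglongrightarrow> (T ^^ n) (h b) i" for n i
  proof (induction n arbitrary: i)
    case (Suc n)
    show ?case
      using convT[of "H * r ^ n" "\<lambda>k. (Tk k ^^ n) (h b)" "(T ^^ n) (h b)", OF bounded_op_pow_dominated[OF Tk h[OF ab(2)]] Suc]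
      by simp
  qed simp
  then have lim: "(\<lambda>k. lk k a ((Tk k ^^ n) (h b))) \<longlonglongrightarrow> l a ((T ^^ n) (h b))" for n
    by (rule convl[OF bounded_op_pow_dominated[OF Tk h[OF ab(2)]] _ ab(1)])
  define d where "d = (\<lambda>n k. (1 / \<rho>) ^ n * cmod (lk k a ((Tk k ^^ n) (h b)) - l a ((T ^^ n) (h b))))"
  have dlim: "(\<lambda>k. d n k) \<longlonglongrightarrow> 0" for n
    unfolding d_def by (rule tendsto_mult_right_zero[OF tendsto_norm_zero[OF LIM_zero[OF lim[of n]]]])
  have dbound: "norm (d n k) \<le> 2 * H * K * (r / \<rho>) ^ n" for n k
  proof -
    have "cmod (lk k a ((Tk k ^^ n) (h b)) - l a ((T ^^ n) (h b))) \<le> H * r ^ n * K + H * r ^ n * K"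
      by (intro order.trans[OF norm_triangle_ineq4] add_mono
          bounded_functional_bound[OF lk[OF ab(1)] bounded_op_pow_dominated[OF Tk h[OF ab(2)]]]
          bounded_functional_bound[OF l[OF ab(1)] bounded_op_pow_dominated[OF T h[OF ab(2)]]])
    then have "d n k \<le> (1 / \<rho>) ^ n * (H * r ^ n * K + H * r ^ n * K)"
      unfolding d_def using \<rho>0 by (intro mult_left_mono) auto
    moreover have "0 \<le> d n k" unfolding d_def using \<rho>0 by simp
    ultimately show ?thesis by (simp add: power_divide mult_ac)
  qed
  have sM: "summable (\<lambda>n. 2 * H * K * (r / \<rho>) ^ n)"
    using r \<rho> by (intro summable_mult summable_geometric) auto
  have sd: "summable (\<lambda>n. d n k)" for k
    by (rule summable_comparison_test'[OF sM]) (rule dbound)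
  have "(\<lambda>k. \<Sum>n. d n k) \<longlonglongrightarrow> (\<Sum>n. 0)"
  proof (rule tannerys_theorem[THEN conjunct2, THEN conjunct2, OF dlim _ sM])
    show "\<forall>\<^sub>F (n, k) in sequentially \<times>\<^sub>F sequentially. norm (d n k) \<le> 2 * H * K * (r / \<rho>) ^ n"
      using dbound by (intro always_eventually) auto
  qed simp
  then have lim0: "(\<lambda>k. 1 / \<rho> * (\<Sum>n. d n k)) \<longlonglongrightarrow> 0"
    using tendsto_mult_right_zero by fastforce
  have est: "dist (reduced_matrix (Tk k) (lk k) h w a b) (reduced_matrix T l h w a b) \<le> 1 / \<rho> * (\<Sum>n. d n k)"
    if w: "w \<in> ?B" for k w
  proof -
    have "(\<lambda>n. w ^ n * lk k a ((Tk k ^^ n) (h b)) - w ^ n * l a ((T ^^ n) (h b)))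
        sums (lk k a (neumann (Tk k) w (h b)) - l a (neumann T w (h b)))"
      by (intro sums_diff neumann_sums[OF Tk wr[OF w] lk[OF ab(1)] hW] neumann_sums[OF T wr[OF w] l[OF ab(1)] hW])
    then have s: "(\<lambda>n. w ^ n * (lk k a ((Tk k ^^ n) (h b)) - l a ((T ^^ n) (h b))))
        sums (lk k a (neumann (Tk k) w (h b)) - l a (neumann T w (h b)))" by (simp add: right_diff_distrib)
    have "cmod (lk k a (neumann (Tk k) w (h b)) - l a (neumann T w (h b))) \<le> (\<Sum>n. d n k)"
      unfolding sums_unique[OF s]
    proof (rule norm_suminf_le)
      show "norm (w ^ n * (lk k a ((Tk k ^^ n) (h b)) - l a ((T ^^ n) (h b)))) \<le> d n k" for n
        unfolding d_def norm_mult norm_power using w by (intro mult_right_mono power_mono) auto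
    qed (rule sd)
    then have "cmod w * cmod (lk k a (neumann (Tk k) w (h b)) - l a (neumann T w (h b))) \<le> 1 / \<rho> * (\<Sum>n. d n k)"
      using w \<rho>0 by (intro mult_mono) auto
    moreover have "dist (reduced_matrix (Tk k) (lk k) h w a b) (reduced_matrix T l h w a b)
        = cmod (w * (lk k a (neumann (Tk k) w (h b)) - l a (neumann T w (h b))))"
      by (simp add: reduced_matrix_def dist_norm norm_minus_commute right_diff_distrib)
    ultimately show ?thesis by (simp add: norm_mult)
  qed
  show "uniform_limit ?B (\<lambda>k w. reduced_matrix (Tk k) (lk k) h w a b) (\<lambda>w. reduced_matrix T l h w a b) sequentially"
  proof (rule uniform_limitI)
    fix e :: real assume "0 < e"
    then have "\<forall>\<^sub>F k in sequentially. 1 / \<rho> * (\<Sum>n. d n k) < e"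
      using order_tendstoD(2)[OF lim0] by blast
    then show "\<forall>\<^sub>F k in sequentially. \<forall>w\<in>?B. dist (reduced_matrix (Tk k) (lk k) h w a b) (reduced_matrix T l h w a b) < e"
      by eventually_elim (use est in \<open>blast intro: order.strict_trans1\<close>)
  qed
qed

end

section \<open>Operators with a geometric drift\<close>

text \<open>Subtracting the value at 0 removes the constants, that is, the eigenvalue 1: if \<open>A\<close> fixes
constants, \<open>centred A\<close> annihilates them, and away from \<open>z = 0\<close> and \<open>z = 1\<close> it has the same eigenvalues as
\<open>A\<close>. This spares the analysis of the simple zero that the determinant would otherwise have at 1.\<close>

definition centred :: "operator \<Rightarrow> operator" where
  "centred A f = (\<lambda>i. A f i - A f 0)"

definition cut_rows :: "nat \<Rightarrow> operator \<Rightarrow> operator" where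
  "cut_rows N A f = (\<lambda>i. if i < N then 0 else A f i)"

text \<open>The finite-rank part of \<open>centred A\<close> collects the first \<open>N\<close> rows of \<open>A\<close> together with the
subtracted value \<open>A f 0\<close>. As 0 is one of these rows, the vector paired with the functional
\<open>A f 0\<close> absorbs the constant sequence and the rank stays at \<open>N\<close>.\<close>

definition split_vec :: "nat \<Rightarrow> nat \<Rightarrow> complex" where
  "split_vec a i = (if i = a then 1 else 0) - (if a = 0 then 1 else 0)"

definition split_det :: "nat \<Rightarrow> operator \<Rightarrow> complex \<Rightarrow> complex" where
  "split_det N A = reduced_det (cut_rows N A) N (\<lambda>a f. A f a) split_vec"

lemma centred_eq_perturbed:
  assumes "0 < N"
  shows "centred A = perturbed (cut_rows N A) N (\<lambda>a f. A f a) split_vec"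
proof (intro ext)
  fix f i
  have "(\<Sum>a<N. A f a * split_vec a i) = (\<Sum>a<N. (if i = a then A f a else 0) - (if a = 0 then A f a else 0))"
    by (intro sum.cong refl) (simp add: split_vec_def)
  also have "\<dots> = (if i < N then A f i else 0) - A f 0"
    using assms by (simp add: sum_subtractf)
  finally show "centred A f i = perturbed (cut_rows N A) N (\<lambda>a f. A f a) split_vec f i"
    by (simp add: centred_def perturbed_def cut_rows_def)
qed

locale drift = weight V for V :: "nat \<Rightarrow> real" +
  fixes \<delta> L :: real
  assumes V_incseq: "incseq V" and V_unbounded: "\<not> bdd_above (range V)"
    and \<delta>: "0 \<le> \<delta>" "\<delta> < 1" and L: "0 < L"
begin

text \<open>What remains of a Markov kernel that satisfies the drift condition: linearity, the bound of the
drift condition for complex sequences, and invariance of constants.\<close>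

definition drift_op :: "operator \<Rightarrow> bool" where
  "drift_op A \<longleftrightarrow> (\<forall>i. bounded_functional (\<delta> * V i + L) (\<lambda>f. A f i)) \<and> (\<forall>a. A (\<lambda>_. a) = (\<lambda>_. a))"

definition centred_eigenvalue :: "operator \<Rightarrow> complex \<Rightarrow> bool" where
  "centred_eigenvalue A z \<longleftrightarrow> (\<exists>g\<in>W. g \<noteq> (\<lambda>_. 0) \<and> (\<forall>i. centred A g i = z * g i))"

definition op_limit :: "(nat \<Rightarrow> operator) \<Rightarrow> operator \<Rightarrow> bool" where
  "op_limit Ak A \<longleftrightarrow> (\<forall>c fk f. (\<forall>k. dominated c (fk k)) \<and> (\<forall>i. (\<lambda>k. fk k i) \<longlonglongrightarrow> f i)
     \<longrightarrow> (\<forall>i. (\<lambda>k. Ak k (fk k) i) \<longlonglongrightarrow> A f i))"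

lemma drift_op_bounded_functional: "drift_op A \<Longrightarrow> bounded_functional (\<delta> * V i + L) (\<lambda>f. A f i)"
  and drift_op_const: "drift_op A \<Longrightarrow> A (\<lambda>_. a) = (\<lambda>_. a)"
  by (auto simp: drift_op_def)

lemma bounded_functional_mono: "bounded_functional K \<phi> \<Longrightarrow> K \<le> K' \<Longrightarrow> bounded_functional K' \<phi>"
  unfolding bounded_functional_def by (meson dominated_nonneg mult_left_mono order_trans)

lemma const_in_W: "(\<lambda>_. a) \<in> W"
  using V_incseq by (intro const_W) (simp add: incseq_def)

lemma drift_op_shift:
  assumes A: "drift_op A" and f: "f \<in> W"
  shows "A (\<lambda>i. f i + a) i = A f i + a"
  using bounded_functional_add[OF drift_op_bounded_functional[OF A] f const_in_W, of 1 a i] drift_op_const[OF A, of a]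
    by simp

lemma split_vec_dominated: "dominated (2 / V 0) (split_vec a)"
proof (rule dominatedI)
  fix i
  have "cmod (split_vec a i) \<le> 2 * 1" by (simp add: split_vec_def)
  also have "\<dots> \<le> 2 * (V i / V 0)"
    using V_pos[of 0] V_incseq by (intro mult_left_mono) (auto simp: incseq_def)
  finally show "cmod (split_vec a i) \<le> 2 / V 0 * V i" by simp
qed

text \<open>Since \<open>V\<close> is unbounded, the constant \<open>L\<close> is absorbed by an arbitrarily small increase of
\<open>\<delta>\<close> on all but finitely many rows. This is the reason why \<open>\<delta>\<close> bounds the essential part of
the spectrum.\<close>

lemma cut_exists:
  assumes "\<delta> < r"
  obtains N where "0 < N" "\<And>i. N \<le> i \<Longrightarrow> \<delta> * V i + L \<le> r * V i"
proof -
  obtain n where n: "L / (r - \<delta>) < V n"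
    using V_unbounded by (auto simp: bdd_above_def not_le)
  show ?thesis
  proof (rule that[of "Suc n"])
    fix i assume "Suc n \<le> i"
    then have "V n \<le> V i" using V_incseq by (auto simp: incseq_def)
    then have "L / (r - \<delta>) \<le> V i" using n by simp
    then show "\<delta> * V i + L \<le> r * V i" using assms by (simp add: field_simps)
  qed simp
qed

context
  fixes r \<rho> N
  assumes r: "\<delta> < r" and N: "0 < N" "\<And>i. N \<le> i \<Longrightarrow> \<delta> * V i + L \<le> r * V i" and \<rho>: "r < \<rho>"
begin

lemma r_pos: "0 < r" and \<rho>_pos: "0 < \<rho>" using r \<delta> \<rho> by auto

lemma cut_bounded_op:
  assumes "drift_op A" shows "bounded_op r (cut_rows N A)"
  unfolding bounded_op_def
proof (intro conjI allI)
  show "bounded_functional (r * V i) (\<lambda>f. cut_rows N A f i)" for i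
  proof (cases "i < N")
    case True
    have "bounded_functional (r * V i) (\<lambda>f. 0)"
      using r_pos V_pos[of i] dominated_nonneg by (intro bounded_functionalI) auto
    then show ?thesis using True by (simp add: cut_rows_def)
  next
    case False
    then have "bounded_functional (r * V i) (\<lambda>f. A f i)"
      using bounded_functional_mono[OF drift_op_bounded_functional[OF assms], of i] N(2)[of i]
        by simp
    then show ?thesis using False by (simp add: cut_rows_def)
  qed
qed (use r_pos in simp)

lemma row_bounded_functional:
  assumes "drift_op A" "a < N" shows "bounded_functional (\<delta> * V N + L) (\<lambda>f. A f a)"
  using V_incseq assms(2) \<delta>
  by (intro bounded_functional_mono[OF drift_op_bounded_functional[OF assms(1)]]) (auto simp: incseq_def intro!: mult_left_mono)

lemma split_det_holomorphic: "drift_op A \<Longrightarrow> split_det N A holomorphic_on ball 0 (1 / r)"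
  unfolding split_det_def
    by (rule reduced_det_holomorphic[OF cut_bounded_op r_pos row_bounded_functional split_vec_dominated])

text \<open>\<open>centred A\<close> is a perturbation of rank at most \<open>N\<close> of an operator with bound \<open>r\<close>, so both
directions are instances of the perturbation theory at \<open>w = 1 / z\<close>.\<close>

lemma split_det_zero_iff:
  assumes "drift_op A" "r < cmod z"
  shows "split_det N A (1 / z) = 0 \<longleftrightarrow> centred_eigenvalue A z"
proof -
  have z: "z \<noteq> 0" and w: "cmod (1 / z) * r < 1"
    using assms(2) r_pos by (auto simp: norm_divide divide_less_eq_1)
  have eq: "g i = 1 / z * centred A g i \<longleftrightarrow> centred A g i = z * g i" for g i
    using z by (auto simp: field_simps)
  note fr = cut_bounded_op[OF assms(1)] r_pos row_bounded_functional[OF assms(1)] split_vec_dominated w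
  show ?thesis
  proof
    assume "split_det N A (1 / z) = 0"
    then obtain g where "g \<in> W" "g \<noteq> (\<lambda>_. 0)" "\<And>i. g i = 1 / z * centred A g i"
      unfolding split_det_def centred_eq_perturbed[OF N(1)]
      using eigenfunction_of_reduced_det_zero[where N = N and l = "\<lambda>a f. A f a" and h = split_vec, OF fr]
        by blast
    then show "centred_eigenvalue A z" unfolding centred_eigenvalue_def eq by blast
  next
    assume "centred_eigenvalue A z"
    then obtain g where g: "g \<in> W" "g \<noteq> (\<lambda>_. 0)" "\<And>i. g i = 1 / z * centred A g i"
      unfolding centred_eigenvalue_def eq[symmetric] by blast
    show "split_det N A (1 / z) = 0"
      unfolding split_det_def
      by (rule reduced_det_zero_of_eigenfunction[where N = N and l = "\<lambda>a f. A f a" and h = split_vec,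
            OF fr g[unfolded centred_eq_perturbed[OF N(1)]]])
  qed
qed

lemma split_det_nonzero:
  assumes "drift_op A" "\<And>z. \<rho> \<le> cmod z \<Longrightarrow> \<not> centred_eigenvalue A z" "cmod w \<le> 1 / \<rho>"
  shows "split_det N A w \<noteq> 0"
proof (cases "w = 0")
  case True
  then show ?thesis by (simp add: split_det_def reduced_det_0)
next
  case False
  have "\<rho> \<le> cmod (1 / w)" using False assms(3) \<rho>_pos by (simp add: norm_divide field_simps)
  then show ?thesis using assms(2)[of "1 / w"] split_det_zero_iff[OF assms(1), of "1 / w"] \<rho> by auto
qed

lemma cball_in_ball: "cball (0 :: complex) (1 / \<rho>) \<subseteq> ball 0 (1 / r)"
  using \<rho> r_pos by (simp add: cball_subset_ball_iff frac_less2)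

lemma split_det_uniform_limit:
  assumes "\<And>k. drift_op (Ak k)" "drift_op A" "op_limit Ak A"
  shows "uniform_limit (cball 0 (1 / \<rho>)) (\<lambda>k. split_det N (Ak k)) (split_det N A) sequentially"
  unfolding split_det_def
proof (rule reduced_det_uniform_limit[OF cut_bounded_op[OF assms(1)] cut_bounded_op[OF assms(2)] r_pos
      row_bounded_functional[OF assms(1)] row_bounded_functional[OF assms(2)] split_vec_dominated _ _ \<rho>])
  fix c fk f a i
  assume f: "\<And>k. dominated c (fk k)" "\<And>i. (\<lambda>k. fk k i) \<longlonglongrightarrow> f i"
  have lim: "(\<lambda>k. Ak k (fk k) i) \<longlonglongrightarrow> A f i" for i
    using assms(3) f unfolding op_limit_def by blast
  show "(\<lambda>k. cut_rows N (Ak k) (fk k) i) \<longlonglongrightarrow> cut_rows N A f i"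
    by (cases "i < N") (use lim in \<open>simp_all add: cut_rows_def\<close>)
  show "(\<lambda>k. Ak k (fk k) a) \<longlonglongrightarrow> A f a" by (rule lim)
qed

lemma centred_power_bound_aux:
  assumes "drift_op A" "\<And>z. \<rho> \<le> cmod z \<Longrightarrow> \<not> centred_eigenvalue A z"
  obtains C where "\<And>c f n. dominated c f \<Longrightarrow> dominated (c * C * \<rho> ^ n) ((centred A ^^ n) f)"
proof -
  have nz: "reduced_det (cut_rows N A) N (\<lambda>a f. A f a) split_vec w \<noteq> 0" if "cmod w \<le> 1 / \<rho>" for w
    using split_det_nonzero[OF assms that] by (simp add: split_det_def)
  show ?thesis
    by (rule perturbed_power_bound[OF cut_bounded_op[OF assms(1)] r_pos row_bounded_functional[OF assms(1)] split_vec_dominated \<rho> nz])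
       (assumption | rule that[unfolded centred_eq_perturbed[OF N(1)]])+
qed

text \<open>On a compact disc free of zeros the limit determinant stays away from 0, hence so do the
approximating ones from some index on.\<close>

lemma no_centred_eigenvalue_limit_aux:
  assumes "\<And>k. drift_op (Ak k)" "drift_op A" "op_limit Ak A" "\<And>z. \<rho> \<le> cmod z \<Longrightarrow> \<not> centred_eigenvalue A z"
  shows "\<forall>\<^sub>F k in sequentially. \<forall>z. \<rho> \<le> cmod z \<longrightarrow> \<not> centred_eigenvalue (Ak k) z"
proof -
  let ?B = "cball (0 :: complex) (1 / \<rho>)"
  have "continuous_on ?B (split_det N A)"
    by (intro holomorphic_on_imp_continuous_on holomorphic_on_subset[OF split_det_holomorphic[OF assms(2)] cball_in_ball])
  moreover have "?B \<noteq> {}" using \<rho>_pos by simp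
  ultimately obtain w0 where w0: "w0 \<in> ?B" "\<And>w. w \<in> ?B \<Longrightarrow> cmod (split_det N A w0) \<le> cmod (split_det N A w)"
    using continuous_attains_inf[OF compact_cball _ continuous_on_norm] by metis
  have "0 < cmod (split_det N A w0)"
    using split_det_nonzero[OF assms(2,4), of w0] w0(1) by simp
  then have "\<forall>\<^sub>F k in sequentially. \<forall>w\<in>?B. dist (split_det N (Ak k) w) (split_det N A w) < cmod (split_det N A w0)"
    using uniform_limitD[OF split_det_uniform_limit[OF assms(1-3)]] by blast
  then show ?thesis
  proof eventually_elim
    case (elim k)
    show ?case
    proof (intro allI impI notI)
      fix z assume z: "\<rho> \<le> cmod z" "centred_eigenvalue (Ak k) z"
      have B: "1 / z \<in> ?B" using z(1) \<rho>_pos by (simp add: norm_divide frac_le)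
      have "split_det N (Ak k) (1 / z) = 0" using split_det_zero_iff[OF assms(1)] z \<rho> by simp
      then show False using bspec[OF elim B] w0(2)[OF B] by (simp add: dist_norm)
    qed
  qed
qed

text \<open>Hurwitz's theorem: if infinitely many of the approximating determinants had no zero near \<open>1 / z\<close>,
their limit would have none there either, unless it is constant. It is not: a determinant vanishing
on a small disc would vanish at the centre, where its value is 1.\<close>

lemma centred_eigenvalue_limit_aux:
  assumes Ak: "\<And>k. drift_op (Ak k)" and A: "drift_op A" and lim: "op_limit Ak A"
    and z: "centred_eigenvalue A z" "\<rho> < cmod z" and U: "open U" "z \<in> U"
  shows "\<forall>\<^sub>F k in sequentially. \<exists>z'\<in>U. centred_eigenvalue (Ak k) z'"
proof (rule ccontr)
  assume "\<not> ?thesis"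
  then have "infinite {k. \<forall>z'\<in>U. \<not> centred_eigenvalue (Ak k) z'}"
    by (simp add: not_eventually frequently_cofinite[symmetric] cofinite_eq_sequentially)
  then obtain s :: "nat \<Rightarrow> nat" where s: "strict_mono s" "\<And>j. s j \<in> {k. \<forall>z'\<in>U. \<not> centred_eigenvalue (Ak k) z'}"
    using infinite_enumerate by blast
  let ?w = "1 / z"
  have z0: "z \<noteq> 0" using z(2) \<rho>_pos by auto
  have w: "?w \<noteq> 0" "cmod ?w < 1 / \<rho>" using z0 z(2) \<rho>_pos by (auto simp: norm_divide frac_less2)
  define Y where "Y = ball 0 (1 / \<rho>) \<inter> ((\<lambda>w. 1 / w) -` U \<inter> (- {0 :: complex}))"
  have "open ((\<lambda>w. 1 / w) -` U \<inter> (- {0 :: complex}))"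
  proof -
    have "continuous_on (- {0 :: complex}) (\<lambda>w. 1 / w)" by (intro continuous_intros) auto
    moreover have "open (- {0 :: complex})" by auto
    ultimately show ?thesis using U(1) continuous_on_open_vimage by blast
  qed
  then have "open Y" unfolding Y_def by auto
  moreover have "?w \<in> Y" unfolding Y_def using w U(2) by simp
  ultimately obtain e where e: "0 < e" "ball ?w e \<subseteq> Y" by (meson openE)
  have sub: "ball ?w e \<subseteq> cball 0 (1 / \<rho>)" using e(2) unfolding Y_def by auto
  have subr: "ball ?w e \<subseteq> ball 0 (1 / r)" using sub cball_in_ball by blast
  have "split_det N A ?w \<noteq> 0"
  proof (rule Hurwitz_no_zeros[of "ball ?w e" "\<lambda>j. split_det N (Ak (s j))" "split_det N A" ?w])
    show "split_det N (Ak (s j)) holomorphic_on ball ?w e" for j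
      by (rule holomorphic_on_subset[OF split_det_holomorphic[OF Ak] subr])
    show "split_det N A holomorphic_on ball ?w e"
      by (rule holomorphic_on_subset[OF split_det_holomorphic[OF A] subr])
    show "uniform_limit K (\<lambda>j. split_det N (Ak (s j))) (split_det N A) sequentially"
      if "compact K" "K \<subseteq> ball ?w e" for K
    proof (rule uniform_limit_on_subset)
      show "uniform_limit (cball 0 (1 / \<rho>)) (\<lambda>j. split_det N (Ak (s j))) (split_det N A) sequentially"
        by (rule filterlim_compose[OF split_det_uniform_limit[OF Ak A lim] filterlim_subseq[OF s(1)]])
      show "K \<subseteq> cball 0 (1 / \<rho>)" using that sub by blast
    qed
    show "\<not> split_det N A constant_on ball ?w e"
    proof
      assume "split_det N A constant_on ball ?w e"
      then have "split_det N A w = split_det N A ?w" if "w \<in> ball ?w e" for w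
        using that e(1) unfolding constant_on_def by (metis centre_in_ball)
      moreover have "split_det N A ?w = 0" using split_det_zero_iff[OF A] z \<rho> by simp
      ultimately have "split_det N A w = 0" if "w \<in> ball ?w e" for w using that by metis
      then have "split_det N A 0 = 0"
        using analytic_continuation_open[of "ball ?w e" "ball 0 (1 / r)" "split_det N A" "\<lambda>_. 0" 0]
          split_det_holomorphic[OF A] subr e(1) r_pos by auto
      then show False by (simp add: split_det_def reduced_det_0)
    qed
    show "split_det N (Ak (s j)) w \<noteq> 0" if "w \<in> ball ?w e" for j w
    proof
      assume D: "split_det N (Ak (s j)) w = 0"
      have "w \<in> Y" using that e(2) by blast
      then have wO: "w \<noteq> 0" "cmod w < 1 / \<rho>" "1 / w \<in> U" by (auto simp: Y_def)
      have "r < cmod (1 / w)" using wO \<rho> \<rho>_pos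
        by (simp add: norm_divide field_simps) (smt (verit) mult_strict_right_mono zero_less_norm_iff)
      then have "centred_eigenvalue (Ak (s j)) (1 / w)" using split_det_zero_iff[OF Ak, of "1 / w"] D
        by simp
      then show False using s(2)[of j] wO(3) by blast
    qed
  qed (use e in auto)
  moreover have "split_det N A ?w = 0" using split_det_zero_iff[OF A] z \<rho> by simp
  ultimately show False by simp
qed

text \<open>The zeros of the determinant in a closed disc form a compact set, so among the
eigenvalues of modulus at least \<open>\<rho>\<close>, if there are any, one has the largest modulus. Hence a bound
by 1 for each of them is a uniform one.\<close>

lemma spectral_gap_aux:
  assumes A: "drift_op A" and "\<And>z. \<delta> < cmod z \<Longrightarrow> centred_eigenvalue A z \<Longrightarrow> cmod z < 1" and "\<rho> < 1"
  shows "\<exists>\<sigma>. \<rho> \<le> \<sigma> \<and> \<sigma> < 1 \<and> (\<forall>z. \<sigma> \<le> cmod z \<longrightarrow> \<not> centred_eigenvalue A z)"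
proof -
  define Z where "Z = {w \<in> cball 0 (1 / \<rho>). split_det N A w = 0}"
  have cont: "continuous_on (cball 0 (1 / \<rho>)) (split_det N A)"
    by (intro holomorphic_on_imp_continuous_on holomorphic_on_subset[OF split_det_holomorphic[OF A] cball_in_ball])
  have "closed Z"
    using continuous_closed_preimage[OF cont closed_cball, of "{0}"]
    by (simp add: Z_def vimage_def Int_def)
  then have "compact Z"
    unfolding Z_def by (metis (no_types, lifting) Collect_mem_eq Collect_mono bounded_cball bounded_subset compact_eq_bounded_closed)
  have Zmem: "1 / z \<in> Z" if "\<rho> \<le> cmod z" "centred_eigenvalue A z" for z
    using that split_det_zero_iff[OF A, of z] \<rho> \<rho>_pos by (auto simp: Z_def norm_divide frac_le)
  show ?thesis
  proof (cases "Z = {}")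
    case True
    then show ?thesis using Zmem assms(3) by blast
  next
    case False
    then obtain w where w: "w \<in> Z" "\<And>w'. w' \<in> Z \<Longrightarrow> cmod w \<le> cmod w'"
      using continuous_attains_inf[OF \<open>compact Z\<close> False continuous_on_norm[OF continuous_on_id]]
        by auto
    have w0: "w \<noteq> 0" using w(1) reduced_det_0 by (auto simp: Z_def split_det_def)
    have wr: "\<rho> \<le> cmod (1 / w)" using w(1) w0 \<rho>_pos by (simp add: Z_def norm_divide field_simps)
    then have "centred_eigenvalue A (1 / w)" using split_det_zero_iff[OF A, of "1 / w"] w(1) \<rho>
      by (simp add: Z_def)
    then have w1: "cmod (1 / w) < 1" using assms(2) wr r \<rho> by auto
    obtain \<sigma> where \<sigma>: "cmod (1 / w) < \<sigma>" "\<sigma> < 1" using dense[OF w1] by blast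
    show ?thesis
    proof (intro exI[of _ \<sigma>] conjI allI impI notI)
      show "\<rho> \<le> \<sigma>" "\<sigma> < 1" using wr \<sigma> by auto
      fix z assume z: "\<sigma> \<le> cmod z" "centred_eigenvalue A z"
      then have "cmod w \<le> cmod (1 / z)" using w(2)[OF Zmem] wr \<sigma> by simp
      moreover have "z \<noteq> 0" using z(1) wr \<sigma> \<rho>_pos by auto
      ultimately have "cmod z \<le> cmod (1 / w)" using w0 by (simp add: norm_divide field_simps)
      then show False using \<sigma> z(1) by simp
    qed
  qed
qed

end

lemma split_exists:
  assumes "\<delta> < \<rho>"
  obtains r N where "\<delta> < r" "0 < N" "\<And>i. N \<le> i \<Longrightarrow> \<delta> * V i + L \<le> r * V i" "r < \<rho>"
proof -
  obtain r where r: "\<delta> < r" "r < \<rho>" using dense[OF assms] by blast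
  obtain N where "0 < N" "\<And>i. N \<le> i \<Longrightarrow> \<delta> * V i + L \<le> r * V i"
    using cut_exists[OF r(1)] by blast
  then show ?thesis using that r by blast
qed

theorem centred_power_bound:
  assumes "drift_op A" "\<delta> < \<rho>" "\<And>z. \<rho> \<le> cmod z \<Longrightarrow> \<not> centred_eigenvalue A z"
  obtains C where "\<And>c f n. dominated c f \<Longrightarrow> dominated (c * C * \<rho> ^ n) ((centred A ^^ n) f)"
proof -
  obtain r N where rN: "\<delta> < r" "0 < N" "\<And>i. N \<le> i \<Longrightarrow> \<delta> * V i + L \<le> r * V i" "r < \<rho>"
    using split_exists[OF assms(2)] by blast
  show ?thesis using centred_power_bound_aux[OF rN assms(1,3)] that by blast
qed

theorem no_centred_eigenvalue_limit:
  assumes "\<And>k. drift_op (Ak k)" "drift_op A" "op_limit Ak A" "\<delta> < \<rho>" "\<And>z. \<rho> \<le> cmod z \<Longrightarrow> \<not> centred_eigenvalue A z"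
  shows "\<forall>\<^sub>F k in sequentially. \<forall>z. \<rho> \<le> cmod z \<longrightarrow> \<not> centred_eigenvalue (Ak k) z"
proof -
  obtain r N where rN: "\<delta> < r" "0 < N" "\<And>i. N \<le> i \<Longrightarrow> \<delta> * V i + L \<le> r * V i" "r < \<rho>"
    using split_exists[OF assms(4)] by blast
  show ?thesis by (rule no_centred_eigenvalue_limit_aux[OF rN assms(1,2,3,5)])
qed

theorem centred_eigenvalue_limit:
  assumes "\<And>k. drift_op (Ak k)" "drift_op A" "op_limit Ak A" "centred_eigenvalue A z" "\<delta> < cmod z" "open U" "z \<in> U"
  shows "\<forall>\<^sub>F k in sequentially. \<exists>z'\<in>U. centred_eigenvalue (Ak k) z'"
proof -
  obtain \<rho> where \<rho>: "\<delta> < \<rho>" "\<rho> < cmod z" using dense[OF assms(5)] by blast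
  obtain r N where rN: "\<delta> < r" "0 < N" "\<And>i. N \<le> i \<Longrightarrow> \<delta> * V i + L \<le> r * V i" "r < \<rho>"
    using split_exists[OF \<rho>(1)] by blast
  show ?thesis by (rule centred_eigenvalue_limit_aux[OF rN assms(1-4) \<rho>(2) assms(6,7)])
qed

theorem spectral_gap:
  assumes "drift_op A" "\<And>z. \<delta> < cmod z \<Longrightarrow> centred_eigenvalue A z \<Longrightarrow> cmod z < 1"
  obtains \<sigma> where "\<delta> < \<sigma>" "\<sigma> < 1" "\<And>z. \<sigma> \<le> cmod z \<Longrightarrow> \<not> centred_eigenvalue A z"
proof -
  obtain \<rho> where \<rho>: "\<delta> < \<rho>" "\<rho> < 1" using dense[OF \<delta>(2)] by blast
  obtain r N where rN: "\<delta> < r" "0 < N" "\<And>i. N \<le> i \<Longrightarrow> \<delta> * V i + L \<le> r * V i" "r < \<rho>"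
    using split_exists[OF \<rho>(1)] by blast
  obtain \<sigma> where "\<rho> \<le> \<sigma>" "\<sigma> < 1" "\<forall>z. \<sigma> \<le> cmod z \<longrightarrow> \<not> centred_eigenvalue A z"
    using spectral_gap_aux[OF rN assms \<rho>(2)] by blast
  then show ?thesis using that \<rho>(1) by (meson less_le_trans)
qed

lemma drift_op_bounded_op: assumes "drift_op A" shows "bounded_op (\<delta> + L / V 0) A"
  unfolding bounded_op_def
proof (intro conjI allI)
  show "0 \<le> \<delta> + L / V 0" using \<delta> L V_pos[of 0] by simp
  fix i
  have "V 0 \<le> V i" using V_incseq by (simp add: incseq_def)
  then have "L \<le> L / V 0 * V i" using L V_pos[of 0] by (simp add: field_simps)
  then show "bounded_functional ((\<delta> + L / V 0) * V i) (\<lambda>f. A f i)"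
    by (intro bounded_functional_mono[OF drift_op_bounded_functional[OF assms]]) (simp add: algebra_simps)
qed

lemma drift_op_pow_W: "drift_op A \<Longrightarrow> f \<in> W \<Longrightarrow> (A ^^ n) f \<in> W"
  by (induction n) (auto intro: bounded_op_W[OF drift_op_bounded_op])

text \<open>Differences to the value at 0 are not changed by subtracting constants at every step.\<close>

lemma centred_pow:
  assumes A: "drift_op A" and f: "f \<in> W"
  shows "(centred A ^^ Suc n) f i = (A ^^ Suc n) f i - (A ^^ Suc n) f 0"
proof (induction n arbitrary: i)
  case (Suc n)
  let ?f = "(A ^^ Suc n) f"
  have "(centred A ^^ Suc n) f = (\<lambda>i. ?f i + (- ?f 0))"
    by (rule ext) (simp only: Suc diff_conv_add_uminus)
  then have "(centred A ^^ Suc (Suc n)) f i = centred A (\<lambda>i. ?f i + (- ?f 0)) i" by simp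
  also have "\<dots> = A ?f i - A ?f 0"
    unfolding centred_def drift_op_shift[OF A drift_op_pow_W[OF A f]] by simp
  finally show ?case by simp
qed (simp add: centred_def)

lemma centred_eigen_pow:
  assumes A: "drift_op A" and g: "g \<in> W" "\<And>i. centred A g i = z * g i"
  shows "(centred A ^^ n) g i = z ^ n * g i"
proof (induction n arbitrary: i)
  case (Suc n)
  have "(centred A ^^ n) g = (\<lambda>i. z ^ n * g i)" by (rule ext) (rule Suc)
  then have "(centred A ^^ Suc n) g i = A (\<lambda>i. z ^ n * g i) i - A (\<lambda>i. z ^ n * g i) 0"
    by (simp add: centred_def)
  also have "\<dots> = z ^ n * centred A g i"
    by (simp add: bounded_functional_mult[OF drift_op_bounded_functional[OF A] g(1)] centred_def right_diff_distrib)
  finally show ?case using g(2) by simp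
qed simp

end

section \<open>Markov kernels with an invariant probability\<close>

text \<open>The bound \<open>U\<close> is a parameter because the lemma serves sequences bounded by \<open>V\<close>, bounded
sequences, and truncations of \<open>V\<close> itself.\<close>

lemma kernel_op_sums:
  fixes h :: "nat \<Rightarrow> 'a::banach"
  assumes "\<And>j. 0 \<le> P i j" "summable (\<lambda>j. P i j * U j)" "\<And>j. norm (h j) \<le> U j"
  shows "summable (\<lambda>j. norm (P i j *\<^sub>R h j))"
    and "(\<lambda>j. P i j *\<^sub>R h j) sums kernel_op P h i"
    and "norm (kernel_op P h i) \<le> (\<Sum>j. P i j * U j)"
proof -
  have le: "norm (P i j *\<^sub>R h j) \<le> P i j * U j" for j
    using assms(1,3) by (simp add: mult_left_mono)
  show s: "summable (\<lambda>j. norm (P i j *\<^sub>R h j))"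
    by (rule summable_comparison_test'[OF assms(2)]) (use le in simp)
  show "(\<lambda>j. P i j *\<^sub>R h j) sums kernel_op P h i"
    unfolding kernel_op_def by (rule summable_sums[OF summable_norm_cancel[OF s]])
  show "norm (kernel_op P h i) \<le> (\<Sum>j. P i j * U j)"
    unfolding kernel_op_def by (rule norm_suminf_le[OF le assms(2)])
qed

text \<open>Fubini for the double series of \<open>p i * P i j * h j\<close>. Summing first over \<open>i\<close>, with the invariance of
\<open>p\<close>, shows that it converges absolutely.\<close>

lemma invariant_integral:
  fixes h :: "nat \<Rightarrow> 'a::banach"
  assumes P: "\<And>i j. 0 \<le> P i j" and p: "\<And>i. 0 \<le> p i" "\<And>j. (\<lambda>i. p i * P i j) sums p j"
    and U: "summable (\<lambda>j. p j * U j)" "\<And>i. summable (\<lambda>j. P i j * U j)" "\<And>j. norm (h j) \<le> U j"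
  shows "summable (\<lambda>j. norm (p j *\<^sub>R h j))"
    and "(\<lambda>i. p i *\<^sub>R kernel_op P h i) sums (\<Sum>j. p j *\<^sub>R h j)"
proof -
  let ?F = "\<lambda>(j, i). (p i * P i j) *\<^sub>R h j"
  show s: "summable (\<lambda>j. norm (p j *\<^sub>R h j))"
    by (rule summable_comparison_test'[OF U(1)]) (use p(1) U(3) in \<open>simp add: mult_left_mono\<close>)
  have col: "((\<lambda>i. norm (?F (j, i))) has_sum p j * norm (h j)) UNIV" for j
  proof -
    have "(\<lambda>i. norm (?F (j, i))) sums (p j * norm (h j))"
      using sums_mult2[OF p(2)[of j], of "norm (h j)"] P p(1) by simp
    then show ?thesis by (intro sums_nonneg_imp_has_sum) auto
  qed
  have abs: "(\<lambda>x. norm (?F x)) summable_on (UNIV \<times> UNIV)"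
    unfolding Infinite_Sum.abs_summable_on_Sigma_iff
  proof (intro conjI ballI)
    show "(\<lambda>i. norm (?F (j, i))) summable_on UNIV" for j
      using has_sum_imp_summable[OF col[of j]] by simp
    have "(\<lambda>j. norm (p j * norm (h j))) summable_on UNIV"
      using s p(1) by (intro summable_nonneg_imp_summable_on) auto
    then show "(\<lambda>j. norm (infsum (\<lambda>i. norm (?F (j, i))) UNIV)) summable_on UNIV"
      using infsumI[OF col] by simp
  qed
  have sF: "?F summable_on (UNIV \<times> UNIV)" by (rule Infinite_Sum.abs_summable_summable[OF abs])
  then have sG: "(\<lambda>(i, j). ?F (j, i)) summable_on (UNIV \<times> UNIV)"
    using summable_on_swap by blast
  have colv: "infsum (\<lambda>i. ?F (j, i)) UNIV = p j *\<^sub>R h j" for j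
  proof -
    have "(\<lambda>i. ?F (j, i)) sums (p j *\<^sub>R h j)"
      using bounded_linear.sums[OF bounded_linear_scaleR_left p(2)[of j], of "h j"] by simp
    moreover have "summable (\<lambda>i. norm (?F (j, i)))"
      using has_sum_imp_sums[OF col[of j]] sums_summable by blast
    ultimately show ?thesis by (intro infsumI norm_summable_imp_has_sum)
  qed
  have rowv: "infsum (\<lambda>j. ?F (j, i)) UNIV = p i *\<^sub>R kernel_op P h i" for i
  proof -
    have "(\<lambda>j. ?F (j, i)) sums (p i *\<^sub>R kernel_op P h i)"
      using bounded_linear.sums[OF bounded_linear_scaleR_right kernel_op_sums(2)[OF P U(2,3)], of "p i"]
        by simp
    moreover have "summable (\<lambda>j. norm (?F (j, i)))"
      using summable_mult[OF kernel_op_sums(1)[OF P U(2,3)], of "\<bar>p i\<bar>"] P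
      by (simp add: abs_mult mult.assoc)
    ultimately show ?thesis by (intro infsumI norm_summable_imp_has_sum)
  qed
  have "infsum (\<lambda>i. infsum (\<lambda>j. ?F (j, i)) UNIV) UNIV = infsum (\<lambda>j. infsum (\<lambda>i. ?F (j, i)) UNIV) UNIV"
    by (rule infsum_swap_banach) (use sG in simp)
  also have "\<dots> = infsum (\<lambda>j. p j *\<^sub>R h j) UNIV" by (simp only: colv)
  also have "\<dots> = (\<Sum>j. p j *\<^sub>R h j)"
    by (intro infsumI norm_summable_imp_has_sum s summable_sums summable_norm_cancel[OF s])
  finally have "infsum (\<lambda>i. p i *\<^sub>R kernel_op P h i) UNIV = (\<Sum>j. p j *\<^sub>R h j)" by (simp only: rowv)
  moreover have "(\<lambda>i. infsum (\<lambda>j. ?F (j, i)) UNIV) summable_on UNIV"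
    using summable_on_Sigma_banach[OF sG] by simp
  ultimately have "((\<lambda>i. p i *\<^sub>R kernel_op P h i) has_sum (\<Sum>j. p j *\<^sub>R h j)) UNIV"
    unfolding rowv using has_sum_infsum by metis
  then show "(\<lambda>i. p i *\<^sub>R kernel_op P h i) sums (\<Sum>j. p j *\<^sub>R h j)" by (rule has_sum_imp_sums)
qed

text \<open>The exponents with \<open>z ^ n = 1\<close> are the multiples of the order of \<open>z\<close>.\<close>

lemma root_of_unity_Gcd:
  fixes z :: complex
  assumes "\<And>n. n \<in> S \<Longrightarrow> z ^ n = 1" "\<And>n. n \<in> S \<Longrightarrow> 1 \<le> n" "Gcd S = (1 :: nat)"
  shows "z = 1"
proof -
  have "S \<noteq> {}" using assms(3) by auto
  then obtain n where n: "n \<in> S" by blast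
  define m where "m = (LEAST m. 0 < m \<and> z ^ m = 1)"
  have m: "0 < m \<and> z ^ m = 1"
    unfolding m_def by (rule LeastI[of _ n]) (use assms(1,2)[OF n] in auto)
  have "m dvd k" if "k \<in> S" for k
  proof -
    have "z ^ (k mod m) = 1"
    proof -
      have "z ^ k = (z ^ m) ^ (k div m) * z ^ (k mod m)"
        by (simp flip: power_mult power_add)
      then show ?thesis using m assms(1)[OF that] by simp
    qed
    moreover have "k mod m < m" using m by simp
    ultimately have "k mod m = 0"
      using not_less_Least[of "k mod m" "\<lambda>m. 0 < m \<and> z ^ m = 1"] unfolding m_def by auto
    then show ?thesis by auto
  qed
  then have "m dvd Gcd S" by (rule Gcd_greatest)
  then show ?thesis using assms(3) m by simp
qed

locale kernel_drift = drift V \<delta> L for V \<delta> L +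
  fixes P :: "nat \<Rightarrow> nat \<Rightarrow> real" and p :: "nat \<Rightarrow> real"
  assumes markov: "markov_kernel P" and irred: "irreducible_kernel P" and aper: "aperiodic_kernel P"
    and inv: "invariant_prob P p"
    and PV_summable: "\<And>i. summable (\<lambda>j. P i j * V j)"
    and PV_drift: "\<And>i. kernel_op P V i \<le> \<delta> * V i + L"
begin

lemma P_nonneg: "0 \<le> P i j" and P_sums: "(\<lambda>j. P i j) sums 1"
  using markov by (auto simp: markov_kernel_def)

lemma p_nonneg: "0 \<le> p i" and p_sums: "p sums 1" and p_inv: "(\<lambda>i. p i * P i j) sums p j"
  using inv by (auto simp: invariant_prob_def)

lemma P_cV_summable: "summable (\<lambda>j. P i j * (a * V j + b))"
  using summable_add[OF summable_mult[OF PV_summable[of i], of a] summable_mult2[OF sums_summable[OF P_sums[of i]], of b]]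
  by (simp add: algebra_simps)

lemma P_cV_sum: "0 \<le> a \<Longrightarrow> (\<Sum>j. P i j * (a * V j + b)) \<le> a * (\<delta> * V i + L) + b"
proof -
  assume a: "0 \<le> a"
  have "(\<lambda>j. a * (P i j * V j) + b * P i j) sums (a * (\<Sum>j. P i j * V j) + b * 1)"
    by (intro sums_add sums_mult summable_sums PV_summable P_sums)
  then have "(\<Sum>j. P i j * (a * V j + b)) = a * kernel_op P V i + b"
    by (simp add: sums_iff algebra_simps kernel_op_def)
  then show ?thesis using mult_left_mono[OF PV_drift[of i] a] by simp
qed

lemma kernel_op_bound:
  fixes f :: "nat \<Rightarrow> complex"
  assumes "0 \<le> a" "\<And>j. cmod (f j) \<le> a * V j + b"
  shows "cmod (kernel_op P f i) \<le> a * (\<delta> * V i + L) + b"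
  using kernel_op_sums(3)[where P = P and i = i and h = f, OF P_nonneg P_cV_summable assms(2)] P_cV_sum[OF assms(1)]
  by (rule order_trans)

lemma kernel_op_W:
  fixes f :: "nat \<Rightarrow> complex"
  assumes "f \<in> W"
  shows "summable (\<lambda>j. norm (P i j *\<^sub>R f j))" and "(\<lambda>j. P i j *\<^sub>R f j) sums kernel_op P f i"
proof -
  obtain c where "dominated c f" using assms W_iff by blast
  then have "cmod (f j) \<le> c * V j + 0" for j using dominatedD by simp
  note * = kernel_op_sums[where P = P and i = i and h = f, OF P_nonneg P_cV_summable this]
  show "summable (\<lambda>j. norm (P i j *\<^sub>R f j))" and "(\<lambda>j. P i j *\<^sub>R f j) sums kernel_op P f i"
    using * by auto
qed

lemma kernel_op_bounded_functional: "bounded_functional (\<delta> * V i + L) (\<lambda>f. kernel_op P f i)"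
proof (rule bounded_functionalI)
  fix f g :: "nat \<Rightarrow> complex" and a assume fg: "f \<in> W" "g \<in> W"
  have "(\<lambda>j. P i j *\<^sub>R f j + a * (P i j *\<^sub>R g j)) sums (kernel_op P f i + a * kernel_op P g i)"
    by (intro sums_add sums_mult kernel_op_W fg)
  then have "(\<lambda>j. P i j *\<^sub>R (f j + a * g j)) sums (kernel_op P f i + a * kernel_op P g i)"
    by (simp add: scaleR_right_distrib)
  then show "kernel_op P (\<lambda>i. f i + a * g i) i = kernel_op P f i + a * kernel_op P g i"
    unfolding kernel_op_def by (rule sums_unique[symmetric])
next
  fix c and f :: "nat \<Rightarrow> complex" assume f: "dominated c f"
  show "cmod (kernel_op P f i) \<le> c * (\<delta> * V i + L)"
    using kernel_op_bound[OF dominated_nonneg[OF f], of f 0] dominatedD[OF f] by simp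
qed

lemma kernel_op_const: "kernel_op P (\<lambda>_. a :: complex) i = a"
  using bounded_linear.sums[OF bounded_linear_scaleR_left P_sums[of i], of a]
  unfolding kernel_op_def by (simp add: sums_iff)

lemma drift_op_kernel: "drift_op (kernel_op P)"
  unfolding drift_op_def using kernel_op_bounded_functional kernel_op_const by auto

text \<open>The truncated and augmented matrix, as an operator on all sequences: with the clipping
\<open>S f j = f (min j k)\<close> it is \<open>S P S\<close>. Clipping fixes constants and, as \<open>V\<close> is increasing,
does not increase bounds by \<open>V\<close>. So the truncated operators inherit the drift condition with
the same constants \<open>\<delta>\<close> and \<open>L\<close>.\<close>

definition trunc_op :: "nat \<Rightarrow> operator" where
  "trunc_op k f i = kernel_op P (\<lambda>j. f (min j k)) (min i k)"

lemma V_min: "V (min i k) \<le> V i"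
  using V_incseq by (simp add: incseq_def)

lemma dominated_min: "dominated c f \<Longrightarrow> dominated c (\<lambda>j. f (min j k))"
  using dominated_nonneg[of c f] dominatedD[of c f] V_min
    by (intro dominatedI) (meson mult_left_mono order_trans)

lemma drift_op_trunc: "drift_op (trunc_op k)"
  unfolding drift_op_def
proof (intro conjI allI bounded_functionalI)
  show "trunc_op k (\<lambda>_. a) = (\<lambda>_. a)" for a
    by (rule ext) (simp add: trunc_op_def kernel_op_const)
next
  fix i f g a assume "f \<in> W" "g \<in> W"
  then have "(\<lambda>j. f (min j k)) \<in> W" "(\<lambda>j. g (min j k)) \<in> W"
    using dominated_min W_iff by meson+
  then show "trunc_op k (\<lambda>i. f i + a * g i) i = trunc_op k f i + a * trunc_op k g i"
    unfolding trunc_op_def by (rule bounded_functional_add[OF kernel_op_bounded_functional])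
next
  fix i c f assume f: "dominated c f"
  have "cmod (trunc_op k f i) \<le> c * (\<delta> * V (min i k) + L)"
    unfolding trunc_op_def
      by (rule bounded_functional_bound[OF kernel_op_bounded_functional dominated_min[OF f]])
  also have "\<dots> \<le> c * (\<delta> * V i + L)"
    using dominated_nonneg[OF f] \<delta> V_min by (intro mult_left_mono add_right_mono) auto
  finally show "cmod (trunc_op k f i) \<le> c * (\<delta> * V i + L)" .
qed

text \<open>Dominated convergence, with the summable sequence \<open>P i j * V j\<close> as dominating one.\<close>

lemma trunc_op_limit: "op_limit trunc_op (kernel_op P)"
  unfolding op_limit_def
proof (intro allI impI, elim conjE)
  fix c fk f i
  assume fk: "\<forall>k. dominated c (fk k)" and lim: "\<forall>i. (\<lambda>k. fk k i) \<longlonglongrightarrow> (f i :: complex)"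
  have "(\<lambda>k. \<Sum>j. P i j *\<^sub>R fk k (min j k)) \<longlonglongrightarrow> (\<Sum>j. P i j *\<^sub>R f j)"
  proof (rule tannerys_theorem[THEN conjunct2, THEN conjunct2])
    fix j
    have "\<forall>\<^sub>F k in sequentially. fk k j = fk k (min j k)"
      using eventually_ge_at_top[of j] by eventually_elim (simp add: min_def)
    then have "(\<lambda>k. fk k (min j k)) \<longlonglongrightarrow> f j"
      using lim tendsto_cong by fastforce
    then show "(\<lambda>k. P i j *\<^sub>R fk k (min j k)) \<longlonglongrightarrow> P i j *\<^sub>R f j" by (intro tendsto_intros)
  next
    have "norm (P i j *\<^sub>R fk k (min j k)) \<le> P i j * (c * V j + 0)" for j k
      using dominatedD[OF dominated_min[OF spec[OF fk, of k]], of j k] P_nonneg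
        by (simp add: mult_left_mono)
    then show "\<forall>\<^sub>F (j, k) in sequentially \<times>\<^sub>F sequentially.
        norm (P i j *\<^sub>R fk k (min j k)) \<le> P i j * (c * V j + 0)"
      by (intro always_eventually) auto
    show "summable (\<lambda>j. P i j * (c * V j + 0))" by (rule P_cV_summable)
  qed simp
  moreover have "\<forall>\<^sub>F k in sequentially. (\<Sum>j. P i j *\<^sub>R fk k (min j k)) = trunc_op k (fk k) i"
    using eventually_ge_at_top[of i]
      by eventually_elim (simp add: trunc_op_def kernel_op_def min_def)
  ultimately show "(\<lambda>k. trunc_op k (fk k) i) \<longlonglongrightarrow> kernel_op P f i"
    unfolding kernel_op_def using tendsto_cong by fastforce
qed

lemma trunc_mat_mult:
  assumes "i \<le> k"
  shows "vec_index (trunc_mat P k *\<^sub>v vec (Suc k) f) i = trunc_op k f i"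
proof -
  have sP: "summable (\<lambda>l. P i (l + k))"
    using sums_summable[OF P_sums[of i]] by (simp add: summable_iff_shift)
  have "summable (\<lambda>j. P i j *\<^sub>R f (min j k))"
  proof -
    have "summable (\<lambda>j. P i (j + k) *\<^sub>R f k)"
      by (rule bounded_linear.summable[OF bounded_linear_scaleR_left sP])
    then show ?thesis
      by (subst summable_iff_shift[symmetric, of _ k]) (simp add: min_absorb2)
  qed
  then have "(\<Sum>j. P i j *\<^sub>R f (min j k))
      = (\<Sum>j. P i (j + k) *\<^sub>R f (min (j + k) k)) + (\<Sum>j<k. P i j *\<^sub>R f (min j k))"
    by (rule suminf_split_initial_segment)
  also have "(\<Sum>j. P i (j + k) *\<^sub>R f (min (j + k) k)) = (\<Sum>l. P i (l + k)) *\<^sub>R f k"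
    using bounded_linear.suminf[OF bounded_linear_scaleR_left sP, of "f k"]
      by (simp add: min_absorb2)
  also have "(\<Sum>j<k. P i j *\<^sub>R f (min j k)) = (\<Sum>j<k. P i j *\<^sub>R f j)"
    by (intro sum.cong) auto
  finally have "trunc_op k f i = (\<Sum>l. P i (l + k)) *\<^sub>R f k + (\<Sum>j<k. P i j *\<^sub>R f j)"
    using assms by (simp add: trunc_op_def kernel_op_def min_def)
  moreover have "vec_index (trunc_mat P k *\<^sub>v vec (Suc k) f) i
      = (\<Sum>j<Suc k. complex_of_real (if j < k then P i j else (\<Sum>l. P i (k + l))) * f j)"
    using assms by (auto simp: trunc_mat_def scalar_prod_def atLeast0LessThan simp del: sum.lessThan_Suc intro!: sum.cong)
  ultimately show ?thesis by (simp add: scaleR_conv_of_real add.commute)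
qed

text \<open>Eigenvectors of the finite matrix extend to sequences that are constant from \<open>k\<close> on, and centring
removes the value at 0. Conversely, a centred eigenfunction becomes an eigenfunction after adding
the constant \<open>a\<close> with \<open>(z - 1) a = A g 0\<close>, which exists because \<open>z \<noteq> 1\<close>. Because \<open>z \<noteq> 0\<close>,
an eigenfunction is determined by its first \<open>k + 1\<close> entries.\<close>

lemma centred_eigenvalue_trunc_iff:
  assumes z: "z \<noteq> 0" "z \<noteq> 1"
  shows "centred_eigenvalue (trunc_op k) z \<longleftrightarrow> z \<in> spectrum (trunc_mat P k)"
proof
  let ?A = "trunc_op k"
  have dims: "dim_row (trunc_mat P k) = Suc k" "dim_col (trunc_mat P k) = Suc k"
    by (auto simp: trunc_mat_def)
  {
    assume "centred_eigenvalue ?A z"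
    then obtain g where g: "g \<in> W" "g \<noteq> (\<lambda>_. 0)" "\<And>i. ?A g i - ?A g 0 = z * g i"
      unfolding centred_eigenvalue_def centred_def by blast
    define a where "a = ?A g 0 / (z - 1)"
    have a: "(z - 1) * a = ?A g 0" using z by (simp add: a_def)
    define f where "f = (\<lambda>i. g i + a)"
    have Af: "?A f i = z * f i" for i
    proof -
      have "?A f i = ?A g i + a" unfolding f_def by (rule drift_op_shift[OF drift_op_trunc g(1)])
      also have "\<dots> = z * g i + (z - 1) * a + a" using g(3)[of i] a by (simp add: algebra_simps)
      finally show ?thesis by (simp add: f_def algebra_simps)
    qed
    have f_min: "f i = f (min i k)" for i
    proof -
      have "?A f i = ?A f (min i k)" by (simp add: trunc_op_def)
      then show ?thesis using z by (simp add: Af)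
    qed
    have "vec (Suc k) f \<noteq> 0\<^sub>v (Suc k)"
    proof
      assume v: "vec (Suc k) f = 0\<^sub>v (Suc k)"
      have f0: "f i = 0" for i
      proof -
        have "vec_index (vec (Suc k) f) (min i k) = 0" unfolding v by simp
        then show ?thesis using f_min[of i] by simp
      qed
      have "g 0 = 0" using g(3)[of 0] z by simp
      then have "a = 0" using f0[of 0] by (simp add: f_def)
      then show False using f0 g(2) by (auto simp: f_def)
    qed
    moreover have "trunc_mat P k *\<^sub>v vec (Suc k) f = z \<cdot>\<^sub>v vec (Suc k) f"
    proof (rule eq_vecI)
      fix i assume "i < dim_vec (z \<cdot>\<^sub>v vec (Suc k) f)"
      then have "i \<le> k" by simp
      then show "vec_index (trunc_mat P k *\<^sub>v vec (Suc k) f) i = vec_index (z \<cdot>\<^sub>v vec (Suc k) f) i"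
        by (simp add: trunc_mat_mult Af)
    qed (simp add: dims)
    ultimately show "z \<in> spectrum (trunc_mat P k)"
      unfolding spectrum_def eigenvalue_def eigenvector_def
        by (auto simp: dims intro!: exI[of _ "vec (Suc k) f"])
  next
    assume "z \<in> spectrum (trunc_mat P k)"
    then obtain v where v: "v \<in> carrier_vec (Suc k)" "v \<noteq> 0\<^sub>v (Suc k)" "trunc_mat P k *\<^sub>v v = z \<cdot>\<^sub>v v"
      unfolding spectrum_def eigenvalue_def eigenvector_def by (auto simp: dims)
    define f where "f = (\<lambda>i. vec_index v (min i k))"
    have vf: "v = vec (Suc k) f" using v(1) by (intro eq_vecI) (auto simp: f_def min_def)
    have Af: "?A f i = z * f i" for i
    proof -
      have "?A f i = ?A f (min i k)" by (simp add: trunc_op_def)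
      also have "\<dots> = vec_index (z \<cdot>\<^sub>v v) (min i k)"
        unfolding v(3)[symmetric] by (subst vf) (simp add: trunc_mat_mult)
      also have "\<dots> = z * f i" using v(1) by (simp add: f_def)
      finally show ?thesis .
    qed
    have "cmod (f i) \<le> (\<Sum>j\<le>k. cmod (f j)) / V 0 * V i" for i
    proof -
      have "cmod (f i) = cmod (f (min i k))" by (simp add: f_def)
      also have "\<dots> \<le> (\<Sum>j\<le>k. cmod (f j))" by (rule member_le_sum) auto
      also have "\<dots> * 1 \<le> (\<Sum>j\<le>k. cmod (f j)) * (V i / V 0)"
        using V_pos[of 0] V_incseq by (intro mult_left_mono sum_nonneg) (auto simp: incseq_def)
      finally show ?thesis by simp
    qed
    then have fW: "f \<in> W" by (intro dominated_W dominatedI)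
    define g where "g = (\<lambda>i. f i + (- f 0))"
    have "g \<in> W" unfolding g_def using W_add[OF fW const_in_W, of 1 "- f 0"] by simp
    moreover have "centred ?A g i = z * g i" for i
      unfolding centred_def g_def drift_op_shift[OF drift_op_trunc fW]
        by (simp add: Af algebra_simps)
    moreover have "g \<noteq> (\<lambda>_. 0)"
    proof
      assume "g = (\<lambda>_. 0)"
      then have c: "f i = f 0" for i by (simp add: g_def fun_eq_iff)
      then have "f = (\<lambda>_. f 0)" by auto
      then have "?A f 0 = f 0" using drift_op_const[OF drift_op_trunc, of k "f 0"] by metis
      then have "f 0 = 0" using Af[of 0] z by simp
      then have "v = 0\<^sub>v (Suc k)" unfolding vf using c by (intro eq_vecI) auto
      then show False using v(2) by blast
    qed
    ultimately show "centred_eigenvalue ?A z" unfolding centred_eigenvalue_def by blast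
  }
qed

section \<open>Integrability of the weight and eigenvalues of the kernel\<close>

abbreviation A :: operator where "A \<equiv> kernel_op P"

text \<open>Integrating the drift inequality \<open>P V \<le> \<delta> V + L\<close> would give the bound \<open>L / (1 - \<delta>)\<close> at once if
\<open>V\<close> were known to be integrable. The truncation \<open>U = min V M\<close> is bounded, so \<open>P U\<close> and \<open>U\<close> have the same
integral, and \<open>U - P U\<close> is at least \<open>(1 - \<delta>) V - L\<close> where \<open>V \<le> M\<close> and at least 0 elsewhere.
Letting \<open>M\<close> grow gives the bound without assuming integrability.\<close>

lemma p_V_summable: "summable (\<lambda>i. p i * V i)"
proof (rule summableI_nonneg_bounded)
  show "0 \<le> p i * V i" for i using p_nonneg V_pos[of i] by simp
  fix n
  \<comment> \<open>With this threshold the first \<open>n\<close> values of \<open>V\<close> are not cut off.\<close>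
  define M where "M = V n"
  define U where "U = (\<lambda>i. min (V i) M)"
  have M: "0 < M" unfolding M_def by (rule V_pos)
  have U0: "0 \<le> U i" for i using M V_pos[of i] by (simp add: U_def)
  have sp: "summable (\<lambda>i. p i * U i)"
    by (rule summable_comparison_test'[OF summable_mult2[OF sums_summable[OF p_sums], of M]])
       (use U0 p_nonneg in \<open>auto simp: U_def abs_mult intro!: mult_left_mono\<close>)
  have sP: "summable (\<lambda>j. P i j * U j)" for i
    by (rule summable_comparison_test'[OF summable_mult2[OF sums_summable[OF P_sums[of i]], of M]])
       (use U0 P_nonneg in \<open>auto simp: U_def abs_mult intro!: mult_left_mono\<close>)
  have "(\<lambda>i. p i *\<^sub>R kernel_op P U i) sums (\<Sum>j. p j *\<^sub>R U j)"
    by (rule invariant_integral(2)[where U = U, OF P_nonneg p_nonneg p_inv sp sP]) (use U0 in simp)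
  moreover have "(\<lambda>i. p i * U i) sums (\<Sum>j. p j *\<^sub>R U j)"
    using summable_sums[OF sp] by simp
  ultimately have "(\<lambda>i. p i * U i - p i *\<^sub>R kernel_op P U i + p i * L) sums ((\<Sum>j. p j *\<^sub>R U j) - (\<Sum>j. p j *\<^sub>R U j) + 1 * L)"
    by (intro sums_add sums_diff sums_mult2 p_sums)
  then have sums_L: "(\<lambda>i. p i * (U i - kernel_op P U i + L)) sums L" by (simp add: algebra_simps)
  have PU_V: "kernel_op P U i \<le> \<delta> * V i + L" for i
  proof -
    have "kernel_op P U i \<le> kernel_op P V i"
      unfolding kernel_op_def using sP PV_summable P_nonneg
      by (intro suminf_le) (auto simp: U_def intro!: mult_left_mono)
    then show ?thesis using PV_drift[of i] by simp
  qed
  have PU_M: "kernel_op P U i \<le> M" for i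
  proof -
    have "(\<Sum>j. P i j * U j) \<le> (\<Sum>j. P i j * M)"
      using sP sums_summable[OF sums_mult2[OF P_sums]] P_nonneg
      by (intro suminf_le) (auto simp: U_def intro!: mult_left_mono)
    then show ?thesis using sums_mult2[OF P_sums[of i], of M] by (simp add: kernel_op_def sums_iff)
  qed
  have nonneg: "0 \<le> U i - kernel_op P U i + L" for i
  proof (cases "V i \<le> M")
    case True
    then have "U i = V i" by (simp add: U_def)
    moreover have "\<delta> * V i \<le> V i" using \<delta> V_pos[of i] by simp
    ultimately show ?thesis using PU_V[of i] by simp
  next
    case False
    then show ?thesis using PU_M[of i] L by (simp add: U_def)
  qed
  have "(1 - \<delta>) * (\<Sum>i<n. p i * V i) = (\<Sum>i<n. p i * ((1 - \<delta>) * V i))"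
    by (simp add: sum_distrib_left mult_ac)
  also have "\<dots> \<le> (\<Sum>i<n. p i * (U i - kernel_op P U i + L))"
  proof (intro sum_mono mult_left_mono p_nonneg)
    fix i assume "i \<in> {..<n}"
    then have "V i \<le> M" using V_incseq by (simp add: M_def incseq_def)
    then show "(1 - \<delta>) * V i \<le> U i - kernel_op P U i + L"
      using PU_V[of i] by (simp add: U_def algebra_simps)
  qed
  also have "\<dots> \<le> (\<Sum>i. p i * (U i - kernel_op P U i + L))"
    using sums_summable[OF sums_L] nonneg p_nonneg by (intro sum_le_suminf) auto
  also have "\<dots> = L" using sums_L by (simp add: sums_iff)
  finally show "(\<Sum>i<n. p i * V i) \<le> L / (1 - \<delta>)" using \<delta> by (simp add: field_simps)
qed

lemma p_integral:
  assumes "f \<in> W"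
  shows "summable (\<lambda>i. norm (p i *\<^sub>R f i))" and "(\<lambda>i. p i *\<^sub>R A f i) sums (\<Sum>i. p i *\<^sub>R f i)"
proof -
  obtain c where c: "dominated c f" using assms W_iff by blast
  have sp: "summable (\<lambda>i. p i * (c * V i))"
    using summable_mult[OF p_V_summable, of c] by (simp add: mult_ac)
  have sP: "summable (\<lambda>j. P i j * (c * V j))" for i using P_cV_summable[of i c 0] by simp
  note * = invariant_integral[where U = "\<lambda>j. c * V j" and h = f, OF P_nonneg p_nonneg p_inv sp sP dominatedD[OF c]]
  show "summable (\<lambda>i. norm (p i *\<^sub>R f i))" and "(\<lambda>i. p i *\<^sub>R A f i) sums (\<Sum>i. p i *\<^sub>R f i)"
    using * by auto
qed

lemma mean_proj_eq: "mean_proj p f i = (\<Sum>i. p i *\<^sub>R f i)"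
  by (simp add: mean_proj_def scaleR_conv_of_real mult.commute)

lemma p_integral_pow:
  assumes "f \<in> W" shows "(\<lambda>i. p i *\<^sub>R (A ^^ n) f i) sums mean_proj p f j"
proof (induction n)
  case 0
  show ?case using summable_sums[OF summable_norm_cancel[OF p_integral(1)[OF assms]]]
    by (simp add: mean_proj_eq)
next
  case (Suc n)
  then show ?case
    using p_integral(2)[OF drift_op_pow_W[OF drift_op_kernel assms], of n] by (simp add: sums_iff)
qed

lemma kernel_pow_bounds: "0 \<le> kernel_pow P n i j \<and> kernel_pow P n i j \<le> 1"
proof (induction n arbitrary: i)
  case (Suc n)
  have le: "P i l * kernel_pow P n l j \<le> P i l" for l
    using Suc[of l] P_nonneg[of i l] by (simp add: mult_left_le)
  have nn: "0 \<le> P i l * kernel_pow P n l j" for l using Suc[of l] P_nonneg[of i l] by simp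
  have s: "summable (\<lambda>l. P i l * kernel_pow P n l j)"
    by (rule summable_comparison_test'[OF sums_summable[OF P_sums[of i]]]) (use le nn in simp)
  show ?case
    using suminf_nonneg[OF s nn] suminf_le[OF le s sums_summable[OF P_sums[of i]]] P_sums[of i]
    by (simp add: sums_iff)
qed simp

lemma kernel_pow_Suc_pos:
  assumes "0 < kernel_pow P (Suc n) i j"
  obtains l where "0 < P i l" "0 < kernel_pow P n l j"
proof -
  have "\<exists>l. P i l * kernel_pow P n l j \<noteq> 0"
  proof (rule ccontr)
    assume "\<not> ?thesis"
    then have "(\<lambda>l. P i l * kernel_pow P n l j) = (\<lambda>_. 0)" by auto
    then show False using assms by simp
  qed
  then obtain l where "P i l \<noteq> 0" "kernel_pow P n l j \<noteq> 0" by auto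
  then show ?thesis using that[of l] P_nonneg[of i l] kernel_pow_bounds[of n l j] by simp
qed

lemma p_pos_step:
  assumes "0 < p i" "0 < P i l" shows "0 < p l"
proof -
  have "sum (\<lambda>i. p i * P i l) {i} \<le> (\<Sum>i. p i * P i l)"
    using sums_summable[OF p_inv[of l]] p_nonneg P_nonneg by (intro sum_le_suminf) auto
  then have "p i * P i l \<le> p l" using p_inv[of l] by (simp add: sums_iff)
  then show ?thesis using mult_pos_pos[OF assms] by simp
qed

text \<open>For \<open>P f = z f\<close> the variance-like sum of \<open>P i j * \<bar>f j - z f i\<bar>\<^sup>2\<close> over \<open>j\<close> equals
\<open>P \<bar>f\<bar>\<^sup>2 - \<bar>z\<bar>\<^sup>2 \<bar>f\<bar>\<^sup>2\<close> at \<open>i\<close>. By invariance its integral is \<open>1 - \<bar>z\<bar>\<^sup>2\<close> times the integral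
of \<open>\<bar>f\<bar>\<^sup>2\<close>, which is not positive for \<open>\<bar>z\<bar> \<ge> 1\<close>. A sum of squares with integral at most 0
vanishes wherever \<open>p\<close> is positive.\<close>

lemma noncontracting_eigenfunction_step:
  assumes f: "\<And>i. cmod (f i) \<le> B" "\<And>i. A f i = z * f i" and z: "1 \<le> cmod z"
    and pos: "0 < p i" "0 < P i j"
  shows "f j = z * f i"
proof -
  define h where "h = (\<lambda>j. (cmod (f j))\<^sup>2)"
  have h: "norm (h j) \<le> B\<^sup>2" for j unfolding h_def using f(1) by (simp add: power_mono)
  have sp: "summable (\<lambda>i. p i * B\<^sup>2)" by (rule sums_summable[OF sums_mult2[OF p_sums]])
  have sP: "summable (\<lambda>j. P i j * B\<^sup>2)" for i by (rule sums_summable[OF sums_mult2[OF P_sums]])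
  define S where "S = (\<Sum>j. p j * h j)"
  have ph: "(\<lambda>j. p j * h j) sums S"
    using invariant_integral(1)[where h = h, OF P_nonneg p_nonneg p_inv sp sP h]
    unfolding S_def by (intro summable_sums) (simp add: summable_norm_cancel)
  have pPh: "(\<lambda>i. p i * kernel_op P h i) sums S"
    using invariant_integral(2)[where h = h, OF P_nonneg p_nonneg p_inv sp sP h]
      by (simp add: S_def)
  have W: "f \<in> W"
  proof (rule dominated_W[of "B / V 0"], rule dominatedI)
    fix i
    have "B * 1 \<le> B * (V i / V 0)"
      using V_incseq V_pos[of 0] order_trans[OF norm_ge_zero f(1)]
      by (intro mult_left_mono) (auto simp: incseq_def)
    then show "cmod (f i) \<le> B / V 0 * V i" using f(1)[of i] by simp
  qed
  have D: "(\<lambda>j. P i j * (cmod (f j - z * f i))\<^sup>2) sums (kernel_op P h i - (cmod z)\<^sup>2 * h i)" for i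
  proof -
    let ?w = "z * f i"
    have "(\<lambda>j. Re (cnj ?w * (P i j *\<^sub>R f j))) sums Re (cnj ?w * ?w)"
      using sums_Re[OF sums_mult[OF kernel_op_W(2)[OF W, of i], of "cnj ?w"]] f(2)[of i] by simp
    moreover have "Re (cnj ?w * ?w) = (cmod ?w)\<^sup>2"
      using complex_norm_square[of ?w] by (metis Re_complex_of_real mult.commute)
    ultimately have 1: "(\<lambda>j. P i j * Re (cnj ?w * f j)) sums (cmod ?w)\<^sup>2"
      by (simp add: algebra_simps)
    have 2: "(\<lambda>j. P i j * h j) sums kernel_op P h i"
      using kernel_op_sums(2)[where h = h and i = i, OF P_nonneg sP h] by simp
    have "(\<lambda>j. P i j * h j - 2 * (P i j * Re (cnj ?w * f j)) + P i j * (cmod ?w)\<^sup>2)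
        sums (kernel_op P h i - 2 * (cmod ?w)\<^sup>2 + 1 * (cmod ?w)\<^sup>2)"
      by (intro sums_add sums_diff sums_mult sums_mult2 1 2 P_sums)
    moreover have "P i j * h j - 2 * (P i j * Re (cnj ?w * f j)) + P i j * (cmod ?w)\<^sup>2
        = P i j * (cmod (f j - ?w))\<^sup>2" for j
    proof -
      have "(cmod (a - w))\<^sup>2 = (cmod a)\<^sup>2 - 2 * Re (cnj w * a) + (cmod w)\<^sup>2" for a w
        unfolding cmod_power2 by (simp add: power2_eq_square algebra_simps)
      moreover have "x * b - 2 * (x * c) + x * d = x * (b - 2 * c + d)" for x b c d :: real
        by (simp add: algebra_simps)
      ultimately show ?thesis by (simp only: h_def)
    qed
    ultimately have "(\<lambda>j. P i j * (cmod (f j - ?w))\<^sup>2) sums (kernel_op P h i - 2 * (cmod ?w)\<^sup>2 + 1 * (cmod ?w)\<^sup>2)"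
      by (simp only:)
    moreover have "(cmod ?w)\<^sup>2 = (cmod z)\<^sup>2 * h i" by (simp add: norm_mult power_mult_distrib h_def)
    ultimately show ?thesis by (simp add: mult.commute)
  qed
  define d where "d = (\<lambda>i. kernel_op P h i - (cmod z)\<^sup>2 * h i)"
  have d0: "0 \<le> d i" for i
    unfolding d_def sums_unique[OF D] using sums_summable[OF D] P_nonneg
      by (intro suminf_nonneg) auto
  have "(\<lambda>i. p i * kernel_op P h i - (cmod z)\<^sup>2 * (p i * h i)) sums (S - (cmod z)\<^sup>2 * S)"
    by (intro sums_diff sums_mult ph pPh)
  then have pd: "(\<lambda>i. p i * d i) sums (S - (cmod z)\<^sup>2 * S)" by (simp add: d_def algebra_simps)
  have S0: "0 \<le> S" unfolding S_def using sums_summable[OF ph] p_nonneg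
    by (intro suminf_nonneg) (auto simp: h_def)
  have "1 * S \<le> (cmod z)\<^sup>2 * S" using z S0 by (intro mult_right_mono) (auto simp: one_le_power)
  then have "suminf (\<lambda>i. p i * d i) \<le> 0" using pd by (simp add: sums_iff)
  moreover have nn: "0 \<le> p i * d i" for i using d0 p_nonneg by simp
  ultimately have "suminf (\<lambda>i. p i * d i) = 0"
    using suminf_nonneg[OF sums_summable[OF pd] nn] by simp
  then have "p i * d i = 0" using suminf_eq_zero_iff[OF sums_summable[OF pd] nn] by blast
  then have "d i = 0" using pos(1) by simp
  then have "(\<lambda>j. P i j * (cmod (f j - z * f i))\<^sup>2) sums 0" using D[of i] by (simp add: d_def)
  moreover have "0 \<le> P i j * (cmod (f j - z * f i))\<^sup>2" for j using P_nonneg by simp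
  ultimately have "P i j * (cmod (f j - z * f i))\<^sup>2 = 0"
    using suminf_eq_zero_iff[of "\<lambda>j. P i j * (cmod (f j - z * f i))\<^sup>2"] by (simp add: sums_iff)
  then show ?thesis using pos(2) by simp
qed

text \<open>Along a path of length \<open>n\<close> the eigenfunction is multiplied by \<open>z ^ n\<close>. Loops at a state \<open>i0\<close> force
\<open>z ^ n = 1\<close> for every return time \<open>n\<close>, hence \<open>z = 1\<close> by aperiodicity, and irreducibility
spreads the value at \<open>i0\<close> to all states.\<close>

lemma noncontracting_eigenfunction_constant:
  assumes f: "\<And>i. cmod (f i) \<le> B" "\<And>i. A f i = z * f i" and z: "1 \<le> cmod z"
  shows "f i = f 0"
proof -
  have chain: "f j = z ^ n * f i" if "0 < p i" "0 < kernel_pow P n i j" for n i j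
    using that
  proof (induction n arbitrary: i)
    case 0
    then show ?case by (simp split: if_splits)
  next
    case (Suc n)
    obtain l where l: "0 < P i l" "0 < kernel_pow P n l j"
      by (rule kernel_pow_Suc_pos[OF Suc.prems(2)])
    have "f l = z * f i" by (rule noncontracting_eigenfunction_step[OF f z Suc.prems(1) l(1)])
    then show ?case using Suc.IH[OF p_pos_step[OF Suc.prems(1) l(1)] l(2)] by simp
  qed
  have "\<exists>i. p i \<noteq> 0"
  proof (rule ccontr)
    assume "\<not> ?thesis"
    then have "p = (\<lambda>_. 0)" by auto
    then show False using p_sums by (simp add: sums_iff)
  qed
  then obtain i0 where i0: "0 < p i0" using p_nonneg by (metis less_le)
  have reach: "\<exists>n. f j = z ^ n * f i0" for j
    using chain[OF i0] irred unfolding irreducible_kernel_def by blast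
  show ?thesis
  proof (cases "f i0 = 0")
    case True
    then show ?thesis using reach[of i] reach[of 0] by auto
  next
    case False
    have "z = 1"
    proof (rule root_of_unity_Gcd)
      show "Gcd {n. 1 \<le> n \<and> 0 < kernel_pow P n i0 i0} = 1" using aper
        by (simp add: aperiodic_kernel_def)
      show "z ^ n = 1" if "n \<in> {n. 1 \<le> n \<and> 0 < kernel_pow P n i0 i0}" for n
        using chain[OF i0, of n i0] that False by simp
    qed auto
    then show ?thesis using reach[of i] reach[of 0] by auto
  qed
qed

text \<open>The drift inequality iterated \<open>n\<close> times, the constants summing to a geometric series.\<close>

lemma A_pow_bound:
  assumes "dominated c f"
  shows "cmod ((A ^^ n) f i) \<le> c * \<delta> ^ n * V i + c * L * (1 - \<delta> ^ n) / (1 - \<delta>)"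
proof (induction n arbitrary: i)
  case (Suc n)
  have "cmod ((A ^^ Suc n) f i) \<le> c * \<delta> ^ n * (\<delta> * V i + L) + c * L * (1 - \<delta> ^ n) / (1 - \<delta>)"
    using kernel_op_bound[of "c * \<delta> ^ n" "(A ^^ n) f", OF _ Suc] dominated_nonneg[OF assms] \<delta>
      by simp
  also have "\<dots> = c * \<delta> ^ Suc n * V i + c * L * (\<delta> ^ n + (1 - \<delta> ^ n) / (1 - \<delta>))"
    by (simp add: algebra_simps)
  also have "\<delta> ^ n + (1 - \<delta> ^ n) / (1 - \<delta>) = (1 - \<delta> ^ Suc n) / (1 - \<delta>)"
    using \<delta> by (simp add: field_simps)
  finally show ?case by simp
qed (use dominatedD[OF assms] in simp)

text \<open>If \<open>\<bar>z\<bar> \<ge> 1\<close>, the iterated drift inequality makes a centred eigenfunction bounded. Adding a suitable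
constant turns it into a bounded eigenfunction of \<open>P\<close>: for \<open>z \<noteq> 1\<close> by solving for the
constant, for \<open>z = 1\<close> because the integral shows that no constant is needed. Such an eigenfunction is
constant, so the centred one vanishes.\<close>

lemma centred_eigenvalue_kernel_less_1:
  assumes z: "\<delta> < cmod z" "centred_eigenvalue A z"
  shows "cmod z < 1"
proof (rule ccontr)
  assume "\<not> cmod z < 1"
  then have z1: "1 \<le> cmod z" by simp
  then have z0: "z \<noteq> 0" by auto
  obtain g where g: "g \<in> W" "g \<noteq> (\<lambda>_. 0)" "\<And>i. centred A g i = z * g i"
    using z(2) unfolding centred_eigenvalue_def by blast
  have g0: "g 0 = 0" using g(3)[of 0] z0 by (simp add: centred_def)
  obtain c where c: "dominated c g" using g(1) W_iff by blast
  define B where "B = 2 * (c * L / (1 - \<delta>))"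
  have bound: "cmod (g i) \<le> B" for i
  proof -
    have "cmod (g i) \<le> c * (V i + V 0) * \<delta> ^ n + B" if n: "1 \<le> n" for n
    proof -
      obtain m where m: "n = Suc m" using n by (cases n) auto
      have le: "c * L * (1 - \<delta> ^ n) / (1 - \<delta>) \<le> c * L / (1 - \<delta>)"
        using \<delta> L dominated_nonneg[OF c] by (intro divide_right_mono mult_left_le) auto
      have "cmod (g i) * 1 \<le> cmod (g i) * cmod z ^ n"
        using z1 by (intro mult_left_mono one_le_power) auto
      also have "\<dots> = cmod ((centred A ^^ n) g i)"
        by (simp add: centred_eigen_pow[OF drift_op_kernel g(1,3)] norm_mult norm_power mult.commute)
      also have "\<dots> \<le> cmod ((A ^^ n) g i) + cmod ((A ^^ n) g 0)"
        unfolding m centred_pow[OF drift_op_kernel g(1)] by (rule norm_triangle_ineq4)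
      also have "\<dots> \<le> (c * \<delta> ^ n * V i + c * L / (1 - \<delta>)) + (c * \<delta> ^ n * V 0 + c * L / (1 - \<delta>))"
        by (intro add_mono order_trans[OF A_pow_bound[OF c, of n]] le order_refl)
      finally show ?thesis by (simp add: B_def algebra_simps)
    qed
    moreover have "(\<lambda>n. c * (V i + V 0) * \<delta> ^ n + B) \<longlonglongrightarrow> c * (V i + V 0) * 0 + B"
      using \<delta> by (intro tendsto_intros LIMSEQ_realpow_zero) auto
    ultimately have "cmod (g i) \<le> c * (V i + V 0) * 0 + B"
      by (intro LIMSEQ_le_const) auto
    then show ?thesis by simp
  qed
  define d where "d = A g 0"
  have Ag: "A g i = z * g i + d" for i using g(3)[of i]
    by (simp add: centred_def d_def algebra_simps)
  \<comment> \<open>The constant whose addition to \<open>g\<close> gives an eigenfunction of \<open>P\<close>.\<close>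
  obtain a where a: "z * a = d + a"
  proof (cases "z = 1")
    case True
    have "(\<lambda>i. p i *\<^sub>R A g i - p i *\<^sub>R g i) sums ((\<Sum>i. p i *\<^sub>R g i) - (\<Sum>i. p i *\<^sub>R g i))"
      by (intro sums_diff p_integral(2)[OF g(1)] summable_sums summable_norm_cancel[OF p_integral(1)[OF g(1)]])
    then have "(\<lambda>i. p i *\<^sub>R d) sums 0" by (simp add: Ag True scaleR_right_distrib)
    moreover have "(\<lambda>i. p i *\<^sub>R d) sums (1 *\<^sub>R d)"
      by (rule bounded_linear.sums[OF bounded_linear_scaleR_left p_sums])
    ultimately have "d = 0" using sums_unique2 by fastforce
    then show ?thesis using that[of 0] by simp
  next
    case False
    then show ?thesis using that[of "d / (z - 1)"] by (simp add: field_simps)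
  qed
  define f where "f = (\<lambda>i. g i + a)"
  have "f i = f 0" for i
  proof (rule noncontracting_eigenfunction_constant[OF _ _ z1])
    show "cmod (f i) \<le> B + cmod a" for i
      unfolding f_def using bound[of i] norm_triangle_ineq[of "g i" a] by linarith
    show "A f i = z * f i" for i
      unfolding f_def drift_op_shift[OF drift_op_kernel g(1)] using a
        by (simp add: Ag algebra_simps)
  qed
  then have "g i = 0" for i using g0 by (simp add: f_def)
  then show False using g(2) by auto
qed

section \<open>Convergence rates and eigenvalues\<close>

text \<open>The powers of the centred operator control \<open>P ^ n f\<close> relative to its value at 0. Integrating this
against \<open>p\<close>, which is possible since \<open>V\<close> is integrable, controls the distance of
that value from the mean of \<open>f\<close>.\<close>

theorem geometric_rateI:
  assumes \<rho>: "\<delta> < \<rho>" and no: "\<And>z. \<rho> \<le> cmod z \<Longrightarrow> \<not> centred_eigenvalue A z"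
  shows "geometric_rate P p V \<rho>"
proof -
  obtain C where C: "\<And>c f n. dominated c f \<Longrightarrow> dominated (c * C * \<rho> ^ n) ((centred A ^^ n) f)"
    using centred_power_bound[OF drift_op_kernel assms] by blast
  have \<rho>0: "0 < \<rho>" using \<rho> \<delta> by simp
  define pV where "pV = (\<Sum>i. p i * V i)"
  have pV: "0 \<le> pV" unfolding pV_def using p_V_summable p_nonneg V_pos
    by (intro suminf_nonneg mult_nonneg_nonneg less_imp_le[OF V_pos])
  have "dominated 1 (\<lambda>i. complex_of_real (V i))" using V_pos
    by (intro dominatedI) (simp add: less_imp_le)
  then have C0: "0 \<le> C" using dominated_nonneg[OF C[of 1 "\<lambda>i. complex_of_real (V i)" 0]] by simp
  \<comment> \<open>The summand 1 only makes the constant positive, as the notion of rate demands.\<close>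
  define C' where "C' = C * (1 + pV / V 0) + 1"
  have est: "dominated (c * C' * \<rho> ^ n) (\<lambda>i. (A ^^ n) f i - mean_proj p f i)"
    if f: "dominated c f" and n: "1 \<le> n" for f c n
  proof (rule dominatedI)
    fix i
    obtain m where m: "n = Suc m" using n by (cases n) auto
    have fW: "f \<in> W" using f dominated_W by blast
    let ?K = "c * C * \<rho> ^ n"
    have K0: "0 \<le> ?K" using dominated_nonneg[OF C[OF f]] .
    have cp: "cmod ((A ^^ n) f i - (A ^^ n) f 0) \<le> ?K * V i" for i
      using dominatedD[OF C[OF f, of n], of i] unfolding m centred_pow[OF drift_op_kernel fW] .
    have "(\<lambda>i. p i *\<^sub>R (A ^^ n) f i - p i *\<^sub>R (A ^^ n) f 0) sums (mean_proj p f 0 - 1 *\<^sub>R (A ^^ n) f 0)"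
      by (intro sums_diff p_integral_pow[OF fW] bounded_linear.sums[OF bounded_linear_scaleR_left p_sums])
    then have s: "(\<lambda>i. p i *\<^sub>R ((A ^^ n) f i - (A ^^ n) f 0)) sums (mean_proj p f 0 - (A ^^ n) f 0)"
      by (simp add: scaleR_right_diff_distrib)
    have "cmod (mean_proj p f 0 - (A ^^ n) f 0) \<le> (\<Sum>i. ?K * (p i * V i))"
      unfolding sums_unique[OF s]
    proof (rule norm_suminf_le)
      show "cmod (p i *\<^sub>R ((A ^^ n) f i - (A ^^ n) f 0)) \<le> ?K * (p i * V i)" for i
        using mult_left_mono[OF cp[of i] p_nonneg[of i]] p_nonneg[of i] by (simp add: mult_ac)
      show "summable (\<lambda>i. ?K * (p i * V i))" by (rule summable_mult[OF p_V_summable])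
    qed
    also have "\<dots> = ?K * pV" unfolding pV_def by (rule suminf_mult[OF p_V_summable])
    finally have mp: "cmod (mean_proj p f 0 - (A ^^ n) f 0) \<le> ?K * pV" .
    have V0: "V 0 \<le> V i" using V_incseq by (simp add: incseq_def)
    have "cmod ((A ^^ n) f i - mean_proj p f i) \<le> ?K * V i + ?K * pV"
    proof -
      have "(A ^^ n) f i - mean_proj p f i = ((A ^^ n) f i - (A ^^ n) f 0) - (mean_proj p f 0 - (A ^^ n) f 0)"
        by (simp add: mean_proj_def)
      then show ?thesis
        using norm_triangle_ineq4[of "(A ^^ n) f i - (A ^^ n) f 0" "mean_proj p f 0 - (A ^^ n) f 0"] cp[of i] mp
          by simp
    qed
    also have "\<dots> \<le> ?K * V i + ?K * (pV / V 0 * V i)"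
    proof -
      have "pV * 1 \<le> pV * (V i / V 0)" using pV V0 V_pos[of 0] by (intro mult_left_mono) auto
      then show ?thesis using K0 by (intro add_left_mono mult_left_mono) auto
    qed
    also have "\<dots> \<le> c * C' * \<rho> ^ n * V i"
      using dominated_nonneg[OF f] \<rho>0 V_pos[of i] by (simp add: C'_def algebra_simps)
    finally show "cmod ((A ^^ n) f i - mean_proj p f i) \<le> c * C' * \<rho> ^ n * V i" .
  qed
  have "0 < C'" unfolding C'_def using C0 pV V_pos[of 0]
    by (intro add_nonneg_pos mult_nonneg_nonneg) auto
  moreover have "(\<lambda>i. (A ^^ n) f i - mean_proj p f i) \<in> W \<and>
      weighted_norm V (\<lambda>i. (A ^^ n) f i - mean_proj p f i) \<le> C' * \<rho> ^ n * weighted_norm V f"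
    if "1 \<le> n" "f \<in> W" for n f
  proof -
    have "dominated (weighted_norm V f * C' * \<rho> ^ n) (\<lambda>i. (A ^^ n) f i - mean_proj p f i)"
      by (rule est[OF W_dominated_norm[OF that(2)] that(1)])
    then show ?thesis using dominated_W weighted_norm_le by (fastforce simp: mult_ac)
  qed
  ultimately show ?thesis unfolding geometric_rate_def by blast
qed

text \<open>On a centred eigenfunction the difference of two values of \<open>P ^ n g\<close> decays exactly like
\<open>\<bar>z\<bar> ^ n\<close>, and the mean cancels from that difference.\<close>

theorem geometric_rate_ge:
  assumes z: "\<delta> < cmod z" "centred_eigenvalue A z" and \<rho>: "geometric_rate P p V \<rho>" "0 < \<rho>"
  shows "cmod z \<le> \<rho>"
proof (rule ccontr)
  assume "\<not> cmod z \<le> \<rho>"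
  then have lt: "\<rho> < cmod z" by simp
  obtain g where g: "g \<in> W" "g \<noteq> (\<lambda>_. 0)" "\<And>i. centred A g i = z * g i"
    using z(2) unfolding centred_eigenvalue_def by blast
  obtain C where C: "\<And>n. 1 \<le> n \<Longrightarrow> (\<lambda>i. (A ^^ n) g i - mean_proj p g i) \<in> W"
      "\<And>n. 1 \<le> n \<Longrightarrow> weighted_norm V (\<lambda>i. (A ^^ n) g i - mean_proj p g i) \<le> C * \<rho> ^ n * weighted_norm V g"
    using \<rho>(1) g(1) unfolding geometric_rate_def by blast
  define K where "K = C * weighted_norm V g"
  have "g i = 0" for i
  proof -
    have "cmod (g i) \<le> (K * (V i + V 0)) * (\<rho> / cmod z) ^ n" if n: "1 \<le> n" for n
    proof -
      obtain m where m: "n = Suc m" using n by (cases n) auto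
      have d: "dominated (K * \<rho> ^ n) (\<lambda>i. (A ^^ n) g i - mean_proj p g i)"
        using dominated_mono[OF W_dominated_norm[OF C(1)[OF n]] C(2)[OF n]]
          by (simp add: K_def mult_ac)
      have "cmod z ^ n * cmod (g i) = cmod ((centred A ^^ n) g i)"
        by (simp add: centred_eigen_pow[OF drift_op_kernel g(1,3)] norm_mult norm_power)
      also have "(centred A ^^ n) g i = ((A ^^ n) g i - mean_proj p g i) - ((A ^^ n) g 0 - mean_proj p g 0)"
        unfolding m centred_pow[OF drift_op_kernel g(1)] by (simp add: mean_proj_def)
      also have "cmod \<dots> \<le> K * \<rho> ^ n * V i + K * \<rho> ^ n * V 0"
        by (intro order_trans[OF norm_triangle_ineq4] add_mono dominatedD[OF d])
      finally have le: "cmod z ^ n * cmod (g i) \<le> K * \<rho> ^ n * V i + K * \<rho> ^ n * V 0" .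
      have pos: "0 < cmod z ^ n" using lt \<rho>(2) by (intro zero_less_power) linarith
      have "cmod (g i) \<le> (K * \<rho> ^ n * V i + K * \<rho> ^ n * V 0) / cmod z ^ n"
        using le by (simp add: pos_le_divide_eq[OF pos] mult.commute)
      also have "\<dots> = (K * (V i + V 0)) * (\<rho> / cmod z) ^ n"
        by (simp add: power_divide algebra_simps add_divide_distrib)
      finally show ?thesis .
    qed
    moreover have "\<rho> / cmod z < 1" using lt \<rho>(2) by (subst divide_less_eq_1_pos) linarith+
    then have "(\<lambda>n. (K * (V i + V 0)) * (\<rho> / cmod z) ^ n) \<longlonglongrightarrow> (K * (V i + V 0)) * 0"
      using \<rho>(2) by (intro tendsto_intros LIMSEQ_realpow_zero) auto
    ultimately have "cmod (g i) \<le> (K * (V i + V 0)) * 0" by (intro LIMSEQ_le_const) auto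
    then show ?thesis by simp
  qed
  then show False using g(2) by auto
qed

lemma trunc_spectrum_finite: "finite {z \<in> spectrum (trunc_mat P k). cmod z < 1}"
  using card_finite_spectrum(1)[of "trunc_mat P k" "Suc k"] by (simp add: trunc_mat_def)

lemma trunc_rate_less:
  assumes "0 < \<rho>" "\<And>z. \<rho> \<le> cmod z \<Longrightarrow> \<not> centred_eigenvalue (trunc_op k) z"
  shows "trunc_rate P k < \<rho>"
proof -
  have "cmod z < \<rho>" if "z \<in> spectrum (trunc_mat P k)" "cmod z < 1" for z
  proof (cases "z = 0")
    case False
    moreover have "z \<noteq> 1" using that(2) by auto
    ultimately have "centred_eigenvalue (trunc_op k) z" using centred_eigenvalue_trunc_iff that(1)
      by blast
    then show ?thesis using assms(2)[of z] by (auto simp: not_le[symmetric])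
  qed (use assms(1) in simp)
  then show ?thesis
    unfolding trunc_rate_def Let_def using trunc_spectrum_finite[of k] assms(1) by auto
qed

lemma trunc_rate_ge:
  assumes "centred_eigenvalue (trunc_op k) z" "0 < cmod z" "cmod z < 1"
  shows "cmod z \<le> trunc_rate P k"
proof -
  have "z \<noteq> 0" "z \<noteq> 1" using assms(2,3) by auto
  then have "z \<in> {z \<in> spectrum (trunc_mat P k). cmod z < 1}" using centred_eigenvalue_trunc_iff assms
    by blast
  then show ?thesis
    unfolding trunc_rate_def Let_def using trunc_spectrum_finite[of k] by (auto intro!: Max_ge)
qed

lemma eventually_trunc_rate_less:
  assumes "\<delta> < \<rho>" "\<And>z. \<rho> \<le> cmod z \<Longrightarrow> \<not> centred_eigenvalue A z"
  shows "\<forall>\<^sub>F k in sequentially. trunc_rate P k < \<rho>"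
proof -
  have "\<forall>\<^sub>F k in sequentially. \<forall>z. \<rho> \<le> cmod z \<longrightarrow> \<not> centred_eigenvalue (trunc_op k) z"
    by (rule no_centred_eigenvalue_limit[OF drift_op_trunc drift_op_kernel trunc_op_limit assms(1)]) (rule assms(2))
  then show ?thesis
  proof eventually_elim
    case (elim k)
    show ?case by (rule trunc_rate_less) (use elim assms(1) \<delta> in auto)
  qed
qed

text \<open>The neighbourhood of \<open>z\<close> in which an eigenvalue of the truncated matrix is sought lies in the punctured
open unit disc, so the eigenvalue found is neither 0 nor 1 and is counted by the truncated rate.\<close>

lemma eventually_trunc_rate_greater:
  assumes z: "\<delta> < cmod z" "centred_eigenvalue A z" "a < cmod z"
  shows "\<forall>\<^sub>F k in sequentially. a < trunc_rate P k"
proof -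
  let ?U = "{y. max a 0 < cmod y} \<inter> {y. cmod y < 1}"
  have "open ?U" by (intro open_Int open_Collect_less continuous_intros)
  moreover have "z \<in> ?U" using z \<delta> centred_eigenvalue_kernel_less_1[OF z(1,2)] by auto
  ultimately have "\<forall>\<^sub>F k in sequentially. \<exists>y\<in>?U. centred_eigenvalue (trunc_op k) y"
    by (rule centred_eigenvalue_limit[OF drift_op_trunc drift_op_kernel trunc_op_limit z(2,1)])
  then show ?thesis
  proof eventually_elim
    case (elim k)
    then obtain y where "centred_eigenvalue (trunc_op k) y" "max a 0 < cmod y" "cmod y < 1" by auto
    then show ?case using trunc_rate_ge[of k y] by simp
  qed
qed

text \<open>The alternative is whether a centred eigenvalue of modulus above \<open>\<delta>\<close> exists. If so, both the rate of
convergence and the limit of the truncated rates equal the supremum \<open>R\<close> of the moduli of these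
eigenvalues. The spectral gap gives \<open>R < 1\<close>, so that rates strictly between \<open>R\<close> and 1 exist.\<close>

theorem rate_dichotomy:
  "(conv_rate P p V \<le> ereal \<delta> \<and> limsup (\<lambda>k. ereal (trunc_rate P k)) \<le> ereal \<delta>) \<or>
   (conv_rate P p V > ereal \<delta> \<and> (\<lambda>k. ereal (trunc_rate P k)) \<longlonglongrightarrow> conv_rate P p V)"
proof (cases "\<exists>z. \<delta> < cmod z \<and> centred_eigenvalue A z")
  case False
  have rate: "conv_rate P p V \<le> ereal \<rho>" if "\<delta> < \<rho>" "\<rho> < 1" for \<rho>
    unfolding conv_rate_def using that \<delta> False
      by (intro Inf_lower imageI) (auto intro: geometric_rateI)
  have lim: "limsup (\<lambda>k. ereal (trunc_rate P k)) \<le> ereal \<rho>" if "\<delta> < \<rho>" for \<rho>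
  proof (rule Limsup_bounded)
    show "\<forall>\<^sub>F k in sequentially. ereal (trunc_rate P k) \<le> ereal \<rho>"
      using eventually_trunc_rate_less[OF that] False that by (force elim: eventually_mono)
  qed
  have "conv_rate P p V \<le> ereal \<delta>"
  proof (rule dense_ge)
    fix y assume "ereal \<delta> < y"
    then obtain \<rho> where \<rho>: "ereal \<delta> < ereal \<rho>" "ereal \<rho> < min y 1"
      using ereal_dense2[of "ereal \<delta>" "min y 1"] \<delta> by (auto simp: one_ereal_def)
    then show "conv_rate P p V \<le> y" using rate[of \<rho>]
      by (auto simp: one_ereal_def intro: order_trans)
  qed
  moreover have "limsup (\<lambda>k. ereal (trunc_rate P k)) \<le> ereal \<delta>"
  proof (rule dense_ge)
    fix y assume "ereal \<delta> < y"
    then obtain \<rho> where \<rho>: "ereal \<delta> < ereal \<rho>" "ereal \<rho> < y" using ereal_dense2 by blast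
    then show "limsup (\<lambda>k. ereal (trunc_rate P k)) \<le> y" using lim[of \<rho>] by (auto intro: order_trans)
  qed
  ultimately show ?thesis by blast
next
  case True
  let ?E = "{z. \<delta> < cmod z \<and> centred_eigenvalue A z}"
  define R where "R = Sup (cmod ` ?E)"
  obtain \<sigma> where \<sigma>: "\<delta> < \<sigma>" "\<sigma> < 1" "\<And>z. \<sigma> \<le> cmod z \<Longrightarrow> \<not> centred_eigenvalue A z"
    using spectral_gap[OF drift_op_kernel centred_eigenvalue_kernel_less_1] by blast
  have le_\<sigma>: "cmod z \<le> \<sigma>" if "z \<in> ?E" for z using \<sigma>(3)[of z] that by force
  have bdd: "bdd_above (cmod ` ?E)" by (rule bdd_aboveI2[OF le_\<sigma>])
  have ne: "cmod ` ?E \<noteq> {}" using True by blast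
  have upper: "cmod z \<le> R" if "z \<in> ?E" for z unfolding R_def using that bdd
    by (intro cSUP_upper) auto
  have "R \<le> \<sigma>" unfolding R_def using le_\<sigma> by (intro cSup_least[OF ne]) auto
  then have R1: "R < 1" using \<sigma>(2) by simp
  have R\<delta>: "\<delta> < R"
  proof -
    obtain z where "z \<in> ?E" using True by blast
    then show ?thesis using upper[of z] by simp
  qed
  have no: "\<not> centred_eigenvalue A z" if "R < \<rho>" "\<rho> \<le> cmod z" for \<rho> z
  proof
    assume "centred_eigenvalue A z"
    then show False using upper[of z] that R\<delta> by simp
  qed
  have "conv_rate P p V = ereal R"
  proof (rule antisym)
    show "conv_rate P p V \<le> ereal R"
    proof (rule dense_ge)
      fix y assume "ereal R < y"
      then obtain \<rho> where \<rho>: "ereal R < ereal \<rho>" "ereal \<rho> < min y 1"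
        using ereal_dense2[of "ereal R" "min y 1"] R1 by (auto simp: one_ereal_def)
      then have "conv_rate P p V \<le> ereal \<rho>"
        unfolding conv_rate_def using R\<delta> \<delta> no[of \<rho>]
        by (intro Inf_lower imageI) (auto simp: one_ereal_def intro!: geometric_rateI)
      then show "conv_rate P p V \<le> y" using \<rho> by (auto intro: order_trans)
    qed
    show "ereal R \<le> conv_rate P p V"
      unfolding conv_rate_def
    proof (rule Inf_greatest, elim imageE, simp, elim conjE)
      fix \<rho> assume "0 < \<rho>" "geometric_rate P p V \<rho>"
      then show "R \<le> \<rho>" unfolding R_def using ne geometric_rate_ge by (intro cSup_least) auto
    qed
  qed
  moreover have "(\<lambda>k. trunc_rate P k) \<longlonglongrightarrow> R"
  proof (rule order_tendstoI)
    fix a assume "a < R"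
    then obtain z where "z \<in> ?E" "a < cmod z" unfolding R_def less_cSup_iff[OF ne bdd] by auto
    then show "\<forall>\<^sub>F k in sequentially. a < trunc_rate P k" using eventually_trunc_rate_greater
      by blast
  next
    fix a assume a: "R < a"
    show "\<forall>\<^sub>F k in sequentially. trunc_rate P k < a"
      using R\<delta> a no[OF a] by (intro eventually_trunc_rate_less) auto
  qed
  ultimately show ?thesis using R\<delta> by simp
qed

end

theorem proposition2:
  fixes P :: "nat \<Rightarrow> nat \<Rightarrow> real" and p V :: "nat \<Rightarrow> real" and \<delta> L :: real
  assumes "markov_kernel P"
    and "irreducible_kernel P"
    and "aperiodic_kernel P"
    and "invariant_prob P p"
    and "\<And>q. invariant_prob P q \<Longrightarrow> q = p"
    and "\<And>n. 0 < V n"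
    and "incseq V"
    and "\<not> bdd_above (range V)"
    and "0 \<le> \<delta>" and "\<delta> < 1" and "0 < L"
    and "\<And>i. summable (\<lambda>j. P i j * V j)"
    and "\<And>i. kernel_op P V i \<le> \<delta> * V i + L"
  shows "(conv_rate P p V \<le> ereal \<delta> \<and> limsup (\<lambda>k. ereal (trunc_rate P k)) \<le> ereal \<delta>) \<or>
         (conv_rate P p V > ereal \<delta> \<and> (\<lambda>k. ereal (trunc_rate P k)) \<longlonglongrightarrow> conv_rate P p V)"
proof -
  interpret kernel_drift V \<delta> L P p
    by unfold_locales (rule assms)+
  show ?thesis by (rule rate_dichotomy)
qed

end
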